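(* Let $1<\alpha<2$, let $M\ge8$ be even, and let $\omega>0$. Let $\epsilon$ satisfy $$\frac{2^\alpha\mu\theta_0}{(M-2)^\alpha}<\epsilon\le\mu\theta_0,$$ and set $k_0=\big\lceil(\mu\theta_0/\epsilon)^{1/\alpha}\big\rceil+1$. Let $\nu=\max_j d_j$ be the largest diagonal entry of $D$. Then there exist matrices $\mathcal P_\omega,\mathcal Q_\omega\in\mathbb R^{2M\times2M}$ such that $$\widetilde{\mathcal F}_\omega^{-1}\mathcal R=\mathcal F_\omega^{-1}\mathcal R+\mathcal P_\omega+\mathcal Q_\omega .$$ These matrices satisfy $\operatorname{rank}(\mathcal P_\omega)=4k_0$, $$\|\mathcal P_\omega\|_2<\frac{2(\omega^2+\nu^2)M^{1/2}\mu}{\omega^2\sqrt{(\omega+1)^2+\big[\frac{2^{\alpha+1}\gamma\tau\theta}{(b-a)^\alpha}\big]^2}}\left[\frac{c_0}{2}-\frac{\theta}{(M-\frac12)^\alpha}\right],$$ and $$\|\mathcal Q_\omega\|_2<\frac{2(\omega^2+\nu^2)M^{1/2}\epsilon}{\omega^2\sqrt{(\omega+1)^2+\big[\frac{2^{\alpha+1}\gamma\tau\theta}{(b-a)^\alpha}\big]^2}} .$$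
   Context: Let $1<\alpha<2$, let $\gamma>0$ and $\tau>0$ be constants, and let $a<b$ be real numbers. Let $M$ be a positive integer, $h=(b-a)/(M+1)$ and $\mu=\gamma\tau/h^\alpha$. For $k\in\mathbb Z$ let $$c_k=(-1)^k\frac{\Gamma(\alpha+1)}{\Gamma(\alpha/2-k+1)\,\Gamma(\alpha/2+k+1)}.$$ Then $c_0>0$, $c_k=c_{-k}\le0$ for $k\ge1$, and $\sum_{k\ne0}|c_k|=c_0$. Let $T=\mu\,[c_{i-j}]_{i,j=1}^M$, which is symmetric Toeplitz and positive definite. For even $M$, let $C$ be the Strang circulant approximation of $T$: $C=\mu\,[s_{(i-j)\bmod M}]_{i,j=1}^M$, where - $s_k=c_k$ for $0\le k<M/2$, - $s_{M/2}=0$, - $s_k=c_{M-k}$ for $M/2<k<M$. Let $D=\operatorname{diag}(d_1,\dots,d_M)$ with $d_j\ge0$. Let $I$ denote an identity matrix of the appropriate size. Define $$\mathcal T=\begin{bmatrix} I & T\\ -T & I\end{bmatrix},\quad \mathcal C=\begin{bmatrix} I & C\\ -C & I\end{bmatrix},\quad \mathcal D=\begin{bmatrix} 0 & -D\\ D & 0\end{bmatrix},\quad \mathcal R=\begin{bmatrix} I & T-D\\ D-T & I\end{bmatrix}=\mathcal T+\mathcal D .$$ For $\omega>0$, the NASS preconditioner is $\mathcal F_\omega=\frac1{2\omega}(\omega I+\mathcal T)(\omega I+\mathcal D)$ and the CNAS preconditioner is $\widetilde{\mathcal F}_\omega=\frac1{2\omega}(\omega I+\mathcal C)(\omega I+\mathcal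 D)$. Finally, define the constants $$\theta=\frac{\big(1-\frac{1+\alpha}{5+\alpha/2}\big)^{5+\alpha/2}e^{1+\alpha}\Gamma(\alpha+1)\sin(\pi\alpha/2)}{\pi\alpha},\qquad \theta_0=\frac{\sqrt2\,e^{13/12}\Gamma(\alpha+1)\sin(\pi\alpha/2)}{\pi\alpha}.$$ *)

theory Defs
  imports "HOL-Analysis.Gamma_Function"
          "Jordan_Normal_Form.DL_Rank"
          "Jordan_Normal_Form.Gauss_Jordan_Elimination"
begin

text \<open>Coefficients c_k of the fractional centred difference (k an integer).\<close>
definition frac_coef :: "real \<Rightarrow> int \<Rightarrow> real" where
  "frac_coef \<alpha> k = (-1) powi k * Gamma (\<alpha> + 1) /
      (Gamma (\<alpha>/2 - of_int k + 1) * Gamma (\<alpha>/2 + of_int k + 1))"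

definition strang_coef :: "real \<Rightarrow> nat \<Rightarrow> nat \<Rightarrow> real" where
  "strang_coef \<alpha> M k =
     (if 2 * k < M then frac_coef \<alpha> (int k)
      else if 2 * k = M then 0
      else frac_coef \<alpha> (int M - int k))"

text \<open>Matrices are 0-indexed (rows/columns 0..M-1), which does not affect
  Toeplitz/circulant structure.\<close>
definition toeplitz_T :: "real \<Rightarrow> real \<Rightarrow> nat \<Rightarrow> real mat" where
  "toeplitz_T \<alpha> \<mu> M = mat M M (\<lambda>(i,j). \<mu> * frac_coef \<alpha> (int i - int j))"

definition strang_C :: "real \<Rightarrow> real \<Rightarrow> nat \<Rightarrow> real mat" where
  "strang_C \<alpha> \<mu> M = mat M M (\<lambda>(i,j). \<mu> * strang_coef \<alpha> M (nat ((int i - int j) mod int M)))"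

definition diag_D :: "nat \<Rightarrow> (nat \<Rightarrow> real) \<Rightarrow> real mat" where
  "diag_D M d = mat M M (\<lambda>(i,j). if i = j then d i else 0)"

definition blk_IX :: "nat \<Rightarrow> real mat \<Rightarrow> real mat" where
  "blk_IX M X = four_block_mat (1\<^sub>m M) X (- X) (1\<^sub>m M)"

definition blk_D :: "nat \<Rightarrow> real mat \<Rightarrow> real mat" where
  "blk_D M D = four_block_mat (0\<^sub>m M M) (- D) D (0\<^sub>m M M)"

text \<open>Matrix inverse (all matrices inverted below are invertible).\<close>
definition mat_inv :: "real mat \<Rightarrow> real mat" where
  "mat_inv A = the (mat_inverse A)"

definition precond :: "nat \<Rightarrow> real \<Rightarrow> real mat \<Rightarrow> real mat \<Rightarrow> real mat" where
  "precond n \<omega> X Y = (1 / (2 * \<omega>)) \<cdot>\<^sub>m ((\<omega> \<cdot>\<^sub>m 1\<^sub>m n + X) * (\<omega> \<cdot>\<^sub>m 1\<^sub>m n + Y))"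

definition vec_norm2 :: "real vec \<Rightarrow> real" where
  "vec_norm2 v = sqrt (v \<bullet> v)"

definition mat_norm2 :: "real mat \<Rightarrow> real" where
  "mat_norm2 A = Sup {vec_norm2 (A *\<^sub>v x) / vec_norm2 x | x.
                        x \<in> carrier_vec (dim_col A) \<and> x \<noteq> 0\<^sub>v (dim_col A)}"

definition mat_rank :: "real mat \<Rightarrow> nat" where
  "mat_rank A = vec_space.rank (dim_row A) A"

definition theta_const :: "real \<Rightarrow> real" where
  "theta_const \<alpha> = (1 - (1 + \<alpha>) / (5 + \<alpha>/2)) powr (5 + \<alpha>/2) * exp (1 + \<alpha>)
       * Gamma (\<alpha> + 1) * sin (pi * \<alpha> / 2) / (pi * \<alpha>)"

definition theta0_const :: "real \<Rightarrow> real" where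
  "theta0_const \<alpha> = sqrt 2 * exp (13/12) * Gamma (\<alpha> + 1) * sin (pi * \<alpha> / 2) / (pi * \<alpha>)"

end

theory Submission
  imports Defs "HOL-Analysis.L2_Norm"
begin

text \<open>
  The difference of the two preconditioned matrices is
  \<open>2\<omega> (\<omega>I + \<D>)\<^sup>-\<^sup>1 (\<omega>I + \<C>)\<^sup>-\<^sup>1 (\<T> - \<C>) (\<omega>I + \<T>)\<^sup>-\<^sup>1 \<R>\<close>. The Toeplitz matrix \<open>T - C\<close> vanishes for
  \<open>\<bar>i - j\<bar> < M/2\<close>; its two triangular \<open>k\<^sub>0 \<times> k\<^sub>0\<close> corners yield \<open>P\<close>, of rank exactly \<open>4k\<^sub>0\<close> because the
  other factors are invertible (\<open>\<R>\<close> is the identity plus a skew-symmetric matrix), and the rest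
  yields \<open>Q\<close>. The norms of the two parts are bounded by sums of \<open>\<bar>c\<^sub>k\<bar>\<close>, which telescope to quotients
  \<open>\<Gamma>(k - \<alpha>/2) / \<Gamma>(k + \<alpha>/2)\<close>; log-convexity of \<open>\<Gamma>\<close> compares these with \<open>k\<^sup>-\<^sup>\<alpha>\<close>. The remaining factor
  is at most \<open>1 + \<surd>(\<omega>\<^sup>2 + \<nu>\<^sup>2) / (\<omega> + 1)\<close> in norm, which is less than \<open>\<surd>M (\<omega>\<^sup>2 + \<nu>\<^sup>2) / \<omega>\<^sup>2\<close> as \<open>M \<ge> 8\<close>.
\<close>

section \<open>Coefficients of the fractional centred difference\<close>

text \<open>The sharp constant \<open>asymp_const\<close> is the pivot: \<open>theta_const\<close>
  is at most that constant and \<open>theta0_const\<close> at least. Tails are estimated with the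
  sharp constant and only then weakened: downwards for the spectrum of C and the bracket in the
  bound of P, upwards for the choice of \<open>k\<^sub>0\<close>. The square root in the
  denominators comes from inverting \<omega>I + \<C>. The circulant C is diagonally dominant with
  surplus 2 \<mu> \<open>coef_tail\<close> (M/2), and this dominates a quantity free of M, because
  \<mu> grows like (M+1)^\<alpha> while the tail decays like M^(-\<alpha>). The order of the factors
  matters: with (\<omega>I + \<T>)^(-1) next to \<R> = (\<omega>I + \<T>) - (\<omega>I - \<D>), the
  product is I - (\<omega>I + \<T>)^(-1) (\<omega>I - \<D>), so its bound does not involve the norm
  of T. Bounds are carried as inequalities for every vector, which compose directly; only the
  finished products are passed to the supremum in \<open>mat_norm2\<close>.\<close>

lemma Gamma_real_plus1: "0 < x \<Longrightarrow> Gamma (x + 1) = x * Gamma x" for x :: real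
  by (intro Gamma_plus1) auto

text \<open>For r in [1, 2] the point x + r - 1 lies between x and x + 1, where log-convexity
  interpolates with weight r - 1; one functional equation then reaches x + r.\<close>

lemma Gamma_ratio_le:
  fixes x r :: real
  assumes "0 < x" "1 \<le> r" "r \<le> 2"
  shows "Gamma (x + r) \<le> Gamma x * (x powr (r - 1) * (x + r - 1))"
proof -
  have "ln (Gamma ((1 - (r - 1)) * x + (r - 1) * (x + 1)))
      \<le> (1 - (r - 1)) * ln (Gamma x) + (r - 1) * ln (Gamma (x + 1))"
    using convex_onD[OF log_convex_Gamma_real, of "r - 1" x "x + 1"] assms by simp
  also have "(1 - (r - 1)) * x + (r - 1) * (x + 1) = x + r - 1"
    by (simp add: algebra_simps)
  also have "Gamma (x + 1) = x * Gamma x"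
    using assms by (intro Gamma_plus1) auto
  also have "(1 - (r - 1)) * ln (Gamma x) + (r - 1) * ln (x * Gamma x)
      = ln (Gamma x * x powr (r - 1))"
    using assms Gamma_real_pos[of x] by (simp add: ln_mult ln_powr algebra_simps)
  finally have "Gamma (x + r - 1) \<le> Gamma x * x powr (r - 1)"
    using assms Gamma_real_pos[of x] Gamma_real_pos[of "x + r - 1"] by simp
  then have "(x + r - 1) * Gamma (x + r - 1) \<le> (x + r - 1) * (Gamma x * x powr (r - 1))"
    using assms by (intro mult_left_mono) auto
  moreover have "Gamma (x + r) = (x + r - 1) * Gamma (x + r - 1)"
    using assms Gamma_real_plus1[of "x + r - 1"] by simp
  ultimately show ?thesis
    by (simp add: mult_ac)
qed

text \<open>Here x itself is the interpolated point, between x - 1 and x + r - 1 with weight 1/r;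
  rewriting Gamma (x - 1) as Gamma x / (x - 1) turns the convexity inequality into a lower
  bound.\<close>

lemma Gamma_ratio_ge:
  fixes x r :: real
  assumes "1 < x" "1 \<le> r"
  shows "Gamma x * (x - 1) powr r \<le> Gamma (x + r)"
proof -
  have "ln (Gamma ((1 - 1 / r) * (x - 1) + (1 / r) * (x + r - 1)))
      \<le> (1 - 1 / r) * ln (Gamma (x - 1)) + (1 / r) * ln (Gamma (x + r - 1))"
    using convex_onD[OF log_convex_Gamma_real, of "1 / r" "x - 1" "x + r - 1"] assms by simp
  also have "(1 - 1 / r) * (x - 1) + (1 / r) * (x + r - 1) = x"
    using assms by (simp add: field_simps)
  finally have "r * ln (Gamma x)
      \<le> r * ((1 - 1 / r) * ln (Gamma (x - 1)) + (1 / r) * ln (Gamma (x + r - 1)))"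
    using assms by (intro mult_left_mono) auto
  also have "\<dots> = (r - 1) * ln (Gamma (x - 1)) + ln (Gamma (x + r - 1))"
    using assms by (simp add: field_simps)
  finally have le: "r * ln (Gamma x) \<le> (r - 1) * ln (Gamma (x - 1)) + ln (Gamma (x + r - 1))" .
  have "Gamma x = (x - 1) * Gamma (x - 1)"
    using assms Gamma_real_plus1[of "x - 1"] by simp
  then have "ln (Gamma x) = ln (x - 1) + ln (Gamma (x - 1))"
    using assms Gamma_real_pos[of "x - 1"] by (simp add: ln_mult_pos)
  then have "(r - 1) * ln (Gamma (x - 1)) = (r - 1) * ln (Gamma x) - (r - 1) * ln (x - 1)"
    by (simp add: algebra_simps)
  with le have "ln (Gamma x) + (r - 1) * ln (x - 1) \<le> ln (Gamma (x + r - 1))"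
    by (simp add: algebra_simps)
  moreover have "ln (Gamma x * (x - 1) powr (r - 1)) = ln (Gamma x) + (r - 1) * ln (x - 1)"
    using assms Gamma_real_pos[of x] by (simp add: ln_mult_pos ln_powr)
  ultimately have "ln (Gamma x * (x - 1) powr (r - 1)) \<le> ln (Gamma (x + r - 1))"
    by simp
  then have "Gamma x * (x - 1) powr (r - 1) \<le> Gamma (x + r - 1)"
    using assms Gamma_real_pos[of x] Gamma_real_pos[of "x + r - 1"] by simp
  then have "(x - 1) * (Gamma x * (x - 1) powr (r - 1)) \<le> (x + r - 1) * Gamma (x + r - 1)"
    using assms by (intro mult_mono) auto
  moreover have "Gamma (x + r) = (x + r - 1) * Gamma (x + r - 1)"
    using assms Gamma_real_plus1[of "x + r - 1"] by simp
  moreover have "(x - 1) powr r = (x - 1) * (x - 1) powr (r - 1)"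
    using assms powr_add[of "x - 1" 1 "r - 1"] by simp
  ultimately show ?thesis
    by (simp add: mult_ac)
qed

text \<open>The tail sum of \<open>\<bar>c\<^sub>j\<bar>\<close> over \<open>j \<ge> k\<close> is \<open>asymp_const \<alpha> / k\<^sup>\<alpha>\<close> to leading order;
  telescoping gives it exactly, as \<open>coef_tail \<alpha> k\<close>.\<close>
definition asymp_const :: "real \<Rightarrow> real" where
  "asymp_const \<alpha> = Gamma (\<alpha> + 1) * sin (pi * \<alpha> / 2) / (pi * \<alpha>)"

definition coef_tail :: "real \<Rightarrow> nat \<Rightarrow> real" where
  "coef_tail \<alpha> k = asymp_const \<alpha> * Gamma (real k - \<alpha> / 2) / Gamma (real k + \<alpha> / 2)"

lemma asymp_const_pos:
  assumes "0 < \<alpha>" "\<alpha> < 2"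
  shows "0 < asymp_const \<alpha>"
proof -
  have "0 < sin (pi * \<alpha> / 2)"
    using assms by (intro sin_gt_zero) (auto simp: field_simps)
  then show ?thesis
    using assms by (auto simp: asymp_const_def)
qed

text \<open>Apart from \<open>asymp_const\<close>, the constant consists of (1 - x/n)^n e^x with x =
  1 + \<alpha> and n = 5 + \<alpha>/2, and this is at most 1 by ln y \<le> y - 1.\<close>

lemma theta_const_le:
  assumes "0 < \<alpha>" "\<alpha> < 2"
  shows "theta_const \<alpha> \<le> asymp_const \<alpha>"
proof -
  define x n where "x = 1 + \<alpha>" and "n = 5 + \<alpha> / 2"
  have xn: "0 < n" "0 < 1 - x / n"
    using assms by (auto simp: x_def n_def field_simps)
  have "(1 - x / n) powr n * exp x = exp (n * ln (1 - x / n) + x)"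
    using xn by (simp add: powr_def exp_add)
  moreover have "n * ln (1 - x / n) \<le> n * (- (x / n))"
    using xn ln_le_minus_one[of "1 - x / n"] by (intro mult_left_mono) auto
  then have "n * ln (1 - x / n) + x \<le> 0"
    using xn by simp
  ultimately have "(1 - x / n) powr n * exp x \<le> 1"
    by simp
  then have "((1 - x / n) powr n * exp x) * asymp_const \<alpha> \<le> 1 * asymp_const \<alpha>"
    using asymp_const_pos[OF assms] by (intro mult_right_mono) auto
  then show ?thesis
    by (simp add: theta_const_def asymp_const_def x_def n_def mult_ac)
qed

lemma theta_const_pos:
  assumes "0 < \<alpha>" "\<alpha> < 2"
  shows "0 < theta_const \<alpha>"
proof -
  have "theta_const \<alpha>
      = (1 - (1 + \<alpha>) / (5 + \<alpha>/2)) powr (5 + \<alpha>/2) * exp (1 + \<alpha>) * asymp_const \<alpha>"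
    by (simp add: theta_const_def asymp_const_def)
  moreover have "(1 - (1 + \<alpha>) / (5 + \<alpha>/2)) \<noteq> 0"
    using assms by (auto simp: field_simps)
  ultimately show ?thesis
    using asymp_const_pos[OF assms] by simp
qed

lemma asymp_const_le_theta0:
  assumes "0 < \<alpha>" "\<alpha> < 2"
  shows "asymp_const \<alpha> \<le> theta0_const \<alpha>"
proof -
  have "1 * 1 \<le> sqrt 2 * exp (13 / 12 :: real)"
    by (intro mult_mono) auto
  then have "1 * asymp_const \<alpha> \<le> (sqrt 2 * exp (13 / 12)) * asymp_const \<alpha>"
    using asymp_const_pos[OF assms] by (intro mult_right_mono) auto
  then show ?thesis
    by (simp add: theta0_const_def asymp_const_def)
qed

section \<open>Recurrences, signs and telescoping sums of the coefficients\<close>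

lemma frac_coef_uminus [simp]: "frac_coef \<alpha> (- k) = frac_coef \<alpha> k"
proof -
  have "(- 1 :: real) powi (- k) = (- 1) powi k"
    by (cases "even k") (auto simp: power_int_def)
  then show ?thesis
    by (simp add: frac_coef_def mult.commute)
qed

lemma frac_coef_abs: "frac_coef \<alpha> \<bar>k\<bar> = frac_coef \<alpha> k"
  by (simp add: abs_if)

lemma coef_tail_pos:
  assumes "0 < \<alpha>" "\<alpha> < 2" "1 \<le> k"
  shows "0 < coef_tail \<alpha> k"
  using assms asymp_const_pos[of \<alpha>] by (auto simp: coef_tail_def intro!: divide_pos_pos mult_pos_pos)

lemma coef_tail_Suc:
  assumes "0 < \<alpha>" "\<alpha> < 2" "1 \<le> k"
  shows "coef_tail \<alpha> (Suc k) = coef_tail \<alpha> k * ((real k - \<alpha> / 2) / (real k + \<alpha> / 2))"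
proof -
  have "Gamma (real k - \<alpha> / 2 + 1) = (real k - \<alpha> / 2) * Gamma (real k - \<alpha> / 2)"
    "Gamma (real k + \<alpha> / 2 + 1) = (real k + \<alpha> / 2) * Gamma (real k + \<alpha> / 2)"
    using assms by (intro Gamma_real_plus1; simp)+
  moreover have "real (Suc k) - \<alpha> / 2 = real k - \<alpha> / 2 + 1" "real (Suc k) + \<alpha> / 2 = real k + \<alpha> / 2 + 1"
    by simp_all
  ultimately show ?thesis
    unfolding coef_tail_def by (simp only: times_divide_times_eq mult_ac)
qed

text \<open>Anchors the telescoping sums that start at 1. Euler's reflection formula at s =
  \<alpha>/2 trades the sine in \<open>asymp_const\<close> for Gamma s * Gamma (1 - s).\<close>

lemma coef_tail_1:
  assumes "0 < \<alpha>" "\<alpha> < 2"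
  shows "coef_tail \<alpha> 1 = frac_coef \<alpha> 0 / 2"
proof -
  define s where "s = \<alpha> / 2"
  have s: "0 < s" "s < 1" "\<alpha> = 2 * s"
    using assms by (auto simp: s_def)
  have "complex_of_real (Gamma s * Gamma (1 - s)) = complex_of_real (pi / sin (pi * s))"
  proof -
    have "complex_of_real (Gamma s * Gamma (1 - s)) = Gamma (of_real s) * Gamma (1 - of_real s)"
      unfolding of_real_mult Gamma_complex_of_real[symmetric] by simp
    also have "\<dots> = of_real pi / sin (of_real pi * of_real s)"
      by (rule Gamma_reflection_complex)
    also have "\<dots> = complex_of_real (pi / sin (pi * s))"
      unfolding of_real_mult[symmetric] sin_of_real of_real_divide[symmetric] ..
    finally show ?thesis .
  qed
  then have refl: "Gamma s * Gamma (1 - s) = pi / sin (pi * s)"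
    using of_real_eq_iff by blast
  have sin: "sin (pi * s) > 0"
    using s by (intro sin_gt_zero) auto
  have "Gamma s > 0" using s by auto
  have "Gamma (s + 1) = s * Gamma s"
    using s by (intro Gamma_plus1) auto
  moreover have "Gamma (1 - s) * sin (pi * s) / pi = 1 / Gamma s"
    using refl sin \<open>Gamma s > 0\<close> by (simp add: divide_simps mult_ac)
  moreover have "coef_tail \<alpha> 1
      = Gamma (2 * s + 1) * (Gamma (1 - s) * sin (pi * s) / pi) / (2 * s * Gamma (s + 1))"
    by (simp add: coef_tail_def asymp_const_def s(3) add.commute mult_ac)
  moreover have "frac_coef \<alpha> 0 = Gamma (2 * s + 1) / (Gamma (s + 1) * Gamma (s + 1))"
    by (simp add: frac_coef_def s(3))
  ultimately show ?thesis
    using s \<open>Gamma s > 0\<close> by simp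
qed

text \<open>Replaces the alternating sign and the Gamma values at negative arguments by a rational
  factor, which is negative for k = 0 only.\<close>

lemma frac_coef_Suc:
  assumes "0 < \<alpha>" "\<alpha> < 2"
  shows "frac_coef \<alpha> (int (Suc k))
    = frac_coef \<alpha> (int k) * ((real k - \<alpha> / 2) / (real k + 1 + \<alpha> / 2))"
proof -
  define g where "g = Gamma (\<alpha> / 2 - real k)"
  \<comment> \<open>Since \<alpha>/2 lies strictly between 0 and 1, the argument \<alpha>/2 - k
    avoids every pole of Gamma, so \<open>g\<close> may be cancelled.\<close>
  have notin: "\<alpha> / 2 - real k \<notin> \<int>\<^sub>\<le>\<^sub>0"
  proof
    assume "\<alpha> / 2 - real k \<in> \<int>\<^sub>\<le>\<^sub>0"
    then have "\<alpha> / 2 - real k + real k \<in> \<int>"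
      by (intro Ints_add) (auto elim: nonpos_Ints_cases)
    then obtain z :: int where "\<alpha> / 2 = of_int z"
      by (auto elim: Ints_cases)
    with assms have "0 < real_of_int z" "real_of_int z < 1"
      by auto
    then show False
      by auto
  qed
  then have ne: "g \<noteq> 0" "\<alpha> / 2 - real k \<noteq> 0"
    by (auto simp: g_def Gamma_eq_zero_iff)
  have "Gamma (\<alpha> / 2 - real k + 1) = (\<alpha> / 2 - real k) * g"
    unfolding g_def using notin by (rule Gamma_plus1)
  moreover have "Gamma (\<alpha> / 2 + real k + 1 + 1) = (\<alpha> / 2 + real k + 1) * Gamma (\<alpha> / 2 + real k + 1)"
    using assms by (intro Gamma_plus1) auto
  moreover have "Gamma (\<alpha> / 2 + real k + 1) > 0"
    using assms by (intro Gamma_real_pos) auto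
  moreover have "(-1 :: real) powi int (Suc k) = - ((-1) powi int k)"
    unfolding power_int_of_nat by simp
  moreover have "Gamma (\<alpha> / 2 - real (Suc k) + 1) = g"
    by (simp add: g_def algebra_simps)
  moreover have "\<alpha> / 2 + real (Suc k) + 1 = \<alpha> / 2 + real k + 1 + 1"
    by simp
  moreover have "- p * c / (g * (q * G)) = p * c / ((\<alpha> / 2 - real k) * g * G) * ((real k - \<alpha> / 2) / q)"
    for p c G q :: real
    using ne by (simp add: divide_simps) (simp add: algebra_simps)
  ultimately show ?thesis
    unfolding frac_coef_def of_int_of_nat_eq by (simp only: add_ac)
qed

lemma coef_tail_diff:
  assumes "0 < \<alpha>" "\<alpha> < 2" "1 \<le> k"
  shows "coef_tail \<alpha> k - coef_tail \<alpha> (Suc k) = coef_tail \<alpha> k * (\<alpha> / (real k + \<alpha> / 2))"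
proof -
  have "1 - (real k - \<alpha> / 2) / (real k + \<alpha> / 2) = \<alpha> / (real k + \<alpha> / 2)"
    using assms by (simp add: divide_simps)
  then show ?thesis
    using assms by (metis coef_tail_Suc mult.right_neutral right_diff_distrib)
qed

text \<open>By \<open>coef_tail_diff\<close> the right side is \<open>coef_tail\<close> times
  \<alpha> / (k + \<alpha>/2). Both sides then obey the same first-order recurrence, and
  \<open>coef_tail_1\<close> matches them at k = 1.\<close>

lemma frac_coef_eq_tail_diff:
  assumes "0 < \<alpha>" "\<alpha> < 2" "1 \<le> k"
  shows "- frac_coef \<alpha> (int k) = coef_tail \<alpha> k - coef_tail \<alpha> (Suc k)"
  using assms(3)
proof (induction k rule: dec_induct)
  case base
  have "frac_coef \<alpha> (int 1) = frac_coef \<alpha> 0 * ((0 - \<alpha> / 2) / (0 + 1 + \<alpha> / 2))"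
    using assms frac_coef_Suc[of \<alpha> 0] by simp
  also have "(0 - \<alpha> / 2) / (0 + 1 + \<alpha> / 2) = - ((\<alpha> / (real 1 + \<alpha> / 2)) / 2)"
    using assms by (simp add: divide_simps)
  finally have "- frac_coef \<alpha> (int 1) = coef_tail \<alpha> 1 * (\<alpha> / (real 1 + \<alpha> / 2))"
    using assms coef_tail_1[of \<alpha>] by (simp only:) simp
  then show ?case
    using assms coef_tail_diff[of \<alpha> 1] by simp
next
  case (step k)
  define x where "x = real k"
  have "1 \<le> x" using step by (simp add: x_def)
  have "- frac_coef \<alpha> (int (Suc k))
      = - frac_coef \<alpha> (int k) * ((x - \<alpha> / 2) / (x + 1 + \<alpha> / 2))"
    using assms frac_coef_Suc[of \<alpha> k] by (simp add: x_def)
  also have "- frac_coef \<alpha> (int k) = coef_tail \<alpha> k * (\<alpha> / (x + \<alpha> / 2))"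
    using step assms coef_tail_diff[of \<alpha> k] by (simp add: x_def)
  also have "\<dots> * ((x - \<alpha> / 2) / (x + 1 + \<alpha> / 2))
      = coef_tail \<alpha> k * ((x - \<alpha> / 2) / (x + \<alpha> / 2)) * (\<alpha> / (x + 1 + \<alpha> / 2))"
    by simp
  also have "\<dots> = coef_tail \<alpha> (Suc k) - coef_tail \<alpha> (Suc (Suc k))"
    using step assms coef_tail_diff[of \<alpha> "Suc k"] coef_tail_Suc[of \<alpha> k] by (simp add: x_def add_ac)
  finally show ?case .
qed

lemma frac_coef_neg:
  assumes "0 < \<alpha>" "\<alpha> < 2" "1 \<le> k"
  shows "frac_coef \<alpha> (int k) < 0"
proof -
  have "coef_tail \<alpha> (Suc k) < coef_tail \<alpha> k * 1"
    unfolding coef_tail_Suc[OF assms] using assms coef_tail_pos[OF assms]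
    by (intro mult_strict_left_mono) auto
  then show ?thesis
    using frac_coef_eq_tail_diff[OF assms] by simp
qed

text \<open>The terms are negative and successive ratios lie in (0, 1), so they increase towards 0.
  Strictness is what later keeps the corner diagonals of T - C nonzero.\<close>

lemma frac_coef_strict_mono:
  assumes "0 < \<alpha>" "\<alpha> < 2" "1 \<le> j" "j < k"
  shows "frac_coef \<alpha> (int j) < frac_coef \<alpha> (int k)"
proof -
  have "frac_coef \<alpha> (int k) < frac_coef \<alpha> (int (Suc k))" if "1 \<le> k" for k
  proof -
    have "frac_coef \<alpha> (int k) * 1
        < frac_coef \<alpha> (int k) * ((real k - \<alpha> / 2) / (real k + 1 + \<alpha> / 2))"
      using frac_coef_neg[OF assms(1,2) that] assms that by (intro mult_strict_left_mono_neg) auto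
    then show ?thesis
      using assms by (simp only: frac_coef_Suc)
  qed
  then have "frac_coef \<alpha> (int (Suc i)) < frac_coef \<alpha> (int (Suc (Suc i)))" for i
    by (metis le_add1 plus_1_eq_Suc)
  \<comment> \<open>The index is shifted by one because monotonicity starts only at 1: the
    coefficient at 0 is positive.\<close>
  from lift_Suc_mono_less[of "\<lambda>i. frac_coef \<alpha> (int (Suc i))", OF this, of "j - 1" "k - 1"]
  show ?thesis
    using assms by (simp del: of_nat_Suc)
qed

lemma sum_frac_coef:
  assumes "0 < \<alpha>" "\<alpha> < 2" "1 \<le> m" "m \<le> n"
  shows "(\<Sum>k = m..<n. - frac_coef \<alpha> (int k)) = coef_tail \<alpha> m - coef_tail \<alpha> n"
proof -
  have "(\<Sum>k = m..<n. - frac_coef \<alpha> (int k)) = (\<Sum>k = m..<n. coef_tail \<alpha> k - coef_tail \<alpha> (Suc k))"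
    using assms by (intro sum.cong refl frac_coef_eq_tail_diff) auto
  also have "\<dots> = - (\<Sum>k = m..<n. coef_tail \<alpha> (Suc k) - coef_tail \<alpha> k)"
    by (simp flip: sum_negf)
  also have "\<dots> = coef_tail \<alpha> m - coef_tail \<alpha> n"
    using assms by (simp add: sum_Suc_diff'[of m n "coef_tail \<alpha>"])
  finally show ?thesis .
qed

text \<open>With x = k - \<alpha>/2 both factors x and x + \<alpha> - 1 of the Gamma quotient bound
  are at most k, the second because \<alpha> < 2.\<close>

lemma coef_tail_ge:
  assumes "1 < \<alpha>" "\<alpha> < 2" "1 \<le> k"
  shows "asymp_const \<alpha> / real k powr \<alpha> \<le> coef_tail \<alpha> k"
proof -
  define x where "x = real k - \<alpha> / 2"
  have x: "0 < x" "x \<le> real k" "x + \<alpha> - 1 \<le> real k" "x + \<alpha> = real k + \<alpha> / 2"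
    using assms by (auto simp: x_def field_simps)
  have "Gamma (x + \<alpha>) \<le> Gamma x * (x powr (\<alpha> - 1) * (x + \<alpha> - 1))"
    using assms x by (intro Gamma_ratio_le) auto
  also have "\<dots> \<le> Gamma x * (real k powr (\<alpha> - 1) * real k)"
    using assms x by (intro mult_left_mono mult_mono powr_mono2) auto
  also have "real k powr (\<alpha> - 1) * real k = real k powr \<alpha>"
    using assms powr_add[of "real k" "\<alpha> - 1" 1] by simp
  finally have "Gamma (x + \<alpha>) \<le> Gamma x * real k powr \<alpha>" .
  then have "asymp_const \<alpha> * Gamma (x + \<alpha>) \<le> asymp_const \<alpha> * (Gamma x * real k powr \<alpha>)"
    using asymp_const_pos[of \<alpha>] assms by (intro mult_left_mono) auto
  moreover have "0 < Gamma (x + \<alpha>)"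
    using assms x by (intro Gamma_real_pos) auto
  ultimately show ?thesis
    using assms unfolding coef_tail_def x(4)[symmetric] x_def[symmetric]
    by (simp add: field_simps)
qed

text \<open>The drop from k + 1 to k - 1 has two causes: \<open>Gamma_ratio_ge\<close> loses 1, and
  the shift \<alpha>/2 is rounded up to 1.\<close>

lemma coef_tail_Suc_le:
  assumes "1 < \<alpha>" "\<alpha> < 2" "2 \<le> k"
  shows "coef_tail \<alpha> (Suc k) \<le> asymp_const \<alpha> / (real k - 1) powr \<alpha>"
proof -
  define x where "x = real (Suc k) - \<alpha> / 2"
  have x: "1 < x" "real k - 1 \<le> x - 1" "x + \<alpha> = real (Suc k) + \<alpha> / 2"
    using assms by (auto simp: x_def field_simps)
  have "Gamma x * (real k - 1) powr \<alpha> \<le> Gamma x * (x - 1) powr \<alpha>"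
    using assms x by (intro mult_left_mono powr_mono2) auto
  also have "\<dots> \<le> Gamma (x + \<alpha>)"
    using assms x by (intro Gamma_ratio_ge) auto
  finally have "asymp_const \<alpha> * (Gamma x * (real k - 1) powr \<alpha>) \<le> asymp_const \<alpha> * Gamma (x + \<alpha>)"
    using asymp_const_pos[of \<alpha>] assms by (intro mult_left_mono) auto
  moreover have "0 < Gamma (x + \<alpha>)"
    using assms x by (intro Gamma_real_pos) auto
  ultimately show ?thesis
    using assms unfolding coef_tail_def x(3)[symmetric] x_def[symmetric]
    by (simp add: field_simps)
qed

section \<open>Euclidean operator norms and inverses\<close>

lemma vec_norm2_L2_set:
  assumes "v \<in> carrier_vec n"
  shows "vec_norm2 v = L2_set (\<lambda>i. v $ i) {0..<n}"
  using assms by (simp add: vec_norm2_def L2_set_def scalar_prod_def power2_eq_square)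

lemma vec_norm2_nonneg [simp]: "0 \<le> vec_norm2 v"
  by (simp add: vec_norm2_L2_set[of v "dim_vec v"])

lemma vec_norm2_square: "(vec_norm2 v)\<^sup>2 = v \<bullet> v"
proof -
  have "0 \<le> v \<bullet> v"
    by (auto simp: scalar_prod_def intro!: sum_nonneg)
  then show ?thesis
    by (simp add: vec_norm2_def)
qed

lemma vec_norm2_square_sum:
  assumes "v \<in> carrier_vec n"
  shows "(vec_norm2 v)\<^sup>2 = (\<Sum>i = 0..<n. (v $ i)\<^sup>2)"
  using assms unfolding vec_norm2_square by (simp add: scalar_prod_def power2_eq_square)

lemma vec_norm2_eq_0_iff:
  assumes "v \<in> carrier_vec n"
  shows "vec_norm2 v = 0 \<longleftrightarrow> v = 0\<^sub>v n"
  using assms by (auto simp: vec_norm2_L2_set[OF assms] L2_set_eq_0_iff intro!: eq_vecI)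

lemma vec_norm2_triangle_minus:
  assumes "v \<in> carrier_vec n" "w \<in> carrier_vec n"
  shows "vec_norm2 (v - w) \<le> vec_norm2 v + vec_norm2 w"
proof -
  have "vec_norm2 (v - w) = L2_set (\<lambda>i. v $ i + - (w $ i)) {0..<n}"
    using assms by (subst vec_norm2_L2_set[of _ n]) (auto intro: L2_set_cong)
  also have "\<dots> \<le> L2_set (\<lambda>i. v $ i) {0..<n} + L2_set (\<lambda>i. - (w $ i)) {0..<n}"
    by (rule L2_set_triangle_ineq)
  also have "L2_set (\<lambda>i. - (w $ i)) {0..<n} = L2_set (\<lambda>i. w $ i) {0..<n}"
    by (simp add: L2_set_def)
  finally show ?thesis
    using assms by (simp add: vec_norm2_L2_set)
qed

lemma vec_norm2_smult:
  "vec_norm2 (c \<cdot>\<^sub>v v) = \<bar>c\<bar> * vec_norm2 v"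
proof -
  have "(c \<cdot>\<^sub>v v) \<bullet> (c \<cdot>\<^sub>v v) = c\<^sup>2 * (v \<bullet> v)"
    by (simp add: power2_eq_square)
  then show ?thesis
    by (simp add: vec_norm2_def real_sqrt_mult)
qed

lemma abs_scalar_prod_le:
  assumes "v \<in> carrier_vec n" "w \<in> carrier_vec n"
  shows "\<bar>v \<bullet> w\<bar> \<le> vec_norm2 v * vec_norm2 w"
proof -
  have "\<bar>v \<bullet> w\<bar> \<le> (\<Sum>i = 0..<n. \<bar>v $ i\<bar> * \<bar>w $ i\<bar>)"
    using assms unfolding scalar_prod_def
    by (auto simp: abs_mult intro!: order_trans[OF sum_abs])
  also have "\<dots> \<le> vec_norm2 v * vec_norm2 w"
    using assms by (simp add: vec_norm2_L2_set L2_set_mult_ineq)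
  finally show ?thesis .
qed

lemma mat_norm2_le:
  assumes "A \<in> carrier_mat m n" "0 < n"
    and "\<And>x. x \<in> carrier_vec n \<Longrightarrow> vec_norm2 (A *\<^sub>v x) \<le> c * vec_norm2 x"
  shows "mat_norm2 A \<le> c"
  unfolding mat_norm2_def
proof (rule cSup_least)
  \<comment> \<open>The supremum is over nonzero vectors, so one must exist for a least-upper-bound
    argument to apply.\<close>
  have "unit_vec n 0 \<in> carrier_vec n" "unit_vec n 0 \<noteq> (0\<^sub>v n :: real vec)"
    using assms(2) by (auto dest!: arg_cong[where f = "\<lambda>v :: real vec. vec_index v 0"])
  then show "{vec_norm2 (A *\<^sub>v x) / vec_norm2 x | x.
      x \<in> carrier_vec (dim_col A) \<and> x \<noteq> 0\<^sub>v (dim_col A)} \<noteq> {}"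
    using assms(1) by blast
next
  fix r
  assume "r \<in> {vec_norm2 (A *\<^sub>v x) / vec_norm2 x | x.
      x \<in> carrier_vec (dim_col A) \<and> x \<noteq> 0\<^sub>v (dim_col A)}"
  then obtain x where x: "r = vec_norm2 (A *\<^sub>v x) / vec_norm2 x" "x \<in> carrier_vec n" "x \<noteq> 0\<^sub>v n"
    using assms(1) by auto
  then have "0 < vec_norm2 x"
    using vec_norm2_eq_0_iff[OF x(2)] by (simp add: order.strict_iff_order)
  then show "r \<le> c"
    using assms(3)[OF x(2)] x(1) by (simp add: divide_le_eq)
qed

text \<open>Schur's test: symmetry turns the row sums into column sums.\<close>
lemma vec_norm2_mult_le_row_sum:
  fixes A :: "real mat"
  assumes A: "A \<in> carrier_mat n n" and x: "x \<in> carrier_vec n"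
    and symT: "A\<^sup>T = A"
    and row: "\<And>i. i < n \<Longrightarrow> (\<Sum>j = 0..<n. \<bar>A $$ (i, j)\<bar>) \<le> c"
    and c: "0 \<le> c"
  shows "vec_norm2 (A *\<^sub>v x) \<le> c * vec_norm2 x"
proof -
  have sym: "A $$ (i, j) = A $$ (j, i)" if "i < n" "j < n" for i j
    using A that index_transpose_mat(1)[of i A j] by (simp add: symT)
  have Ax: "(A *\<^sub>v x) $ i = (\<Sum>j = 0..<n. A $$ (i, j) * x $ j)" if "i < n" for i
    using A x that by (auto simp: scalar_prod_def intro!: sum.cong)
  have sq_le: "((A *\<^sub>v x) $ i)\<^sup>2 \<le> c * (\<Sum>j = 0..<n. \<bar>A $$ (i, j)\<bar> * (x $ j)\<^sup>2)" if i: "i < n" for i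
  proof -
    \<comment> \<open>Cauchy-Schwarz with each weight split as a product of two square roots: one
      factor yields the row sum, the other a weighted square sum of x.\<close>
    let ?f = "\<lambda>j. sqrt \<bar>A $$ (i, j)\<bar>" and ?g = "\<lambda>j. sqrt \<bar>A $$ (i, j)\<bar> * \<bar>x $ j\<bar>"
    have "\<bar>(A *\<^sub>v x) $ i\<bar> \<le> (\<Sum>j = 0..<n. \<bar>A $$ (i, j) * x $ j\<bar>)"
      unfolding Ax[OF i] by (rule sum_abs)
    also have "\<dots> = (\<Sum>j = 0..<n. \<bar>?f j\<bar> * \<bar>?g j\<bar>)"
      by (intro sum.cong) (auto simp: abs_mult simp flip: mult.assoc)
    also have "\<dots> \<le> L2_set ?f {0..<n} * L2_set ?g {0..<n}"
      by (rule L2_set_mult_ineq)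
    finally have "\<bar>(A *\<^sub>v x) $ i\<bar>\<^sup>2 \<le> (L2_set ?f {0..<n} * L2_set ?g {0..<n})\<^sup>2"
      by (rule power_mono) auto
    also have "\<dots> = (\<Sum>j = 0..<n. \<bar>A $$ (i, j)\<bar>) * (\<Sum>j = 0..<n. \<bar>A $$ (i, j)\<bar> * (x $ j)\<^sup>2)"
      by (simp add: L2_set_def power_mult_distrib sum_nonneg)
    also have "\<dots> \<le> c * (\<Sum>j = 0..<n. \<bar>A $$ (i, j)\<bar> * (x $ j)\<^sup>2)"
      using row[OF i] by (intro mult_right_mono) (auto intro!: sum_nonneg)
    finally show ?thesis
      by simp
  qed
  have "(vec_norm2 (A *\<^sub>v x))\<^sup>2 = (\<Sum>i = 0..<n. ((A *\<^sub>v x) $ i)\<^sup>2)"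
    using A x by (intro vec_norm2_square_sum) auto
  also have "\<dots> \<le> (\<Sum>i = 0..<n. c * (\<Sum>j = 0..<n. \<bar>A $$ (i, j)\<bar> * (x $ j)\<^sup>2))"
    by (intro sum_mono sq_le) auto
  also have "\<dots> = c * (\<Sum>i = 0..<n. \<Sum>j = 0..<n. \<bar>A $$ (i, j)\<bar> * (x $ j)\<^sup>2)"
    by (simp add: sum_distrib_left)
  also have "(\<Sum>i = 0..<n. \<Sum>j = 0..<n. \<bar>A $$ (i, j)\<bar> * (x $ j)\<^sup>2)
      = (\<Sum>j = 0..<n. \<Sum>i = 0..<n. \<bar>A $$ (j, i)\<bar> * (x $ j)\<^sup>2)"
    by (subst sum.swap) (auto simp: sym intro!: sum.cong)
  also have "\<dots> = (\<Sum>j = 0..<n. (\<Sum>i = 0..<n. \<bar>A $$ (j, i)\<bar>) * (x $ j)\<^sup>2)"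
    by (simp add: sum_distrib_right)
  also have "\<dots> \<le> (\<Sum>j = 0..<n. c * (x $ j)\<^sup>2)"
    using row by (intro sum_mono mult_right_mono) auto
  also have "c * \<dots> = (c * vec_norm2 x)\<^sup>2"
    using vec_norm2_square_sum[OF x]
    by (simp add: power_mult_distrib power2_eq_square[of c] mult.assoc flip: sum_distrib_left)
  finally have "(vec_norm2 (A *\<^sub>v x))\<^sup>2 \<le> (c * vec_norm2 x)\<^sup>2"
    using c by (simp add: mult_left_mono)
  then show ?thesis
    using c by (simp add: power2_le_iff_abs_le)
qed

text \<open>Gershgorin's bound through the quadratic form: 2 |a b| \<le> a^2 + b^2 distributes each
  off-diagonal entry equally over its row and its column, symmetry makes both shares row sums, and
  Cauchy-Schwarz passes from the form to the norm of A x.\<close>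

lemma diag_dominant_norm_ge:
  fixes A :: "real mat"
  assumes A: "A \<in> carrier_mat n n" and x: "x \<in> carrier_vec n"
    and symT: "A\<^sup>T = A"
    and dom: "\<And>i. i < n \<Longrightarrow> l + (\<Sum>j \<in> {0..<n} - {i}. \<bar>A $$ (i, j)\<bar>) \<le> A $$ (i, i)"
  shows "l * vec_norm2 x \<le> vec_norm2 (A *\<^sub>v x)"
proof -
  have sym: "A $$ (i, j) = A $$ (j, i)" if "i < n" "j < n" for i j
    using A that index_transpose_mat(1)[of i A j] by (simp add: symT)
  define S where "S = (\<lambda>i. \<Sum>j \<in> {0..<n} - {i}. \<bar>A $$ (i, j)\<bar>)"
  \<comment> \<open>Zero on the diagonal, so that the double sums run over the full square and can
    be swapped.\<close>
  define off where "off = (\<lambda>i j. if i = j then 0 else \<bar>A $$ (i, j)\<bar>)"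
  have off_sum: "(\<Sum>j = 0..<n. off i j) = S i" if "i < n" for i
  proof -
    have "(\<Sum>j = 0..<n. off i j) = (\<Sum>j \<in> {0..<n} - {i}. off i j)"
      by (intro sum.mono_neutral_right) (auto simp: off_def)
    also have "\<dots> = S i"
      unfolding S_def by (intro sum.cong) (auto simp: off_def)
    finally show ?thesis .
  qed
  have off_sym: "off i j = off j i" if "i < n" "j < n" for i j
    using sym[OF that] by (simp add: off_def)
  have quad: "x \<bullet> (A *\<^sub>v x) = (\<Sum>i = 0..<n. \<Sum>j = 0..<n. A $$ (i, j) * (x $ i * x $ j))"
    using A x by (auto simp: scalar_prod_def sum_distrib_left mult_ac intro!: sum.cong)
  have ab: "- ((a\<^sup>2 + b\<^sup>2) / 2) \<le> a * b" "a * b \<le> (a\<^sup>2 + b\<^sup>2) / 2" for a b :: real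
    using zero_le_power2[of "a + b"] zero_le_power2[of "a - b"]
    by (simp_all add: power2_eq_square field_simps)
  have bound: "(if i = j then A $$ (i, i) * (x $ i)\<^sup>2 else 0) - off i j * (((x $ i)\<^sup>2 + (x $ j)\<^sup>2) / 2)
      \<le> A $$ (i, j) * (x $ i * x $ j)" if "i < n" "j < n" for i j
  proof (cases "i = j")
    case True
    then show ?thesis by (simp add: off_def power2_eq_square)
  next
    case False
    have "\<bar>x $ i * x $ j\<bar> \<le> ((x $ i)\<^sup>2 + (x $ j)\<^sup>2) / 2"
      using ab[of "x $ i" "x $ j"] by linarith
    then have "\<bar>A $$ (i, j) * (x $ i * x $ j)\<bar> \<le> \<bar>A $$ (i, j)\<bar> * (((x $ i)\<^sup>2 + (x $ j)\<^sup>2) / 2)"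
      unfolding abs_mult[of "A $$ (i, j)"] by (intro mult_left_mono) auto
    then show ?thesis
      using False by (simp add: off_def)
  qed
  have swap: "(\<Sum>i = 0..<n. \<Sum>j = 0..<n. off i j * (x $ j)\<^sup>2) = (\<Sum>i = 0..<n. \<Sum>j = 0..<n. off i j * (x $ i)\<^sup>2)"
    by (subst sum.swap) (auto simp: off_sym intro!: sum.cong)
  have S_eq: "(\<Sum>i = 0..<n. \<Sum>j = 0..<n. off i j * (x $ i)\<^sup>2) = (\<Sum>i = 0..<n. S i * (x $ i)\<^sup>2)"
    by (auto simp: off_sum simp flip: sum_distrib_right intro!: sum.cong)
  have "(\<Sum>i = 0..<n. \<Sum>j = 0..<n. off i j * (((x $ i)\<^sup>2 + (x $ j)\<^sup>2) / 2))
      = ((\<Sum>i = 0..<n. \<Sum>j = 0..<n. off i j * (x $ i)\<^sup>2)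
        + (\<Sum>i = 0..<n. \<Sum>j = 0..<n. off i j * (x $ j)\<^sup>2)) / 2"
    unfolding sum.distrib[symmetric] sum_divide_distrib by (simp add: distrib_left)
  also have "\<dots> = (\<Sum>i = 0..<n. S i * (x $ i)\<^sup>2)"
    unfolding swap S_eq by simp
  finally have off_eq: "(\<Sum>i = 0..<n. \<Sum>j = 0..<n. off i j * (((x $ i)\<^sup>2 + (x $ j)\<^sup>2) / 2))
      = (\<Sum>i = 0..<n. S i * (x $ i)\<^sup>2)" .
  have "l * (x \<bullet> x) = (\<Sum>i = 0..<n. l * (x $ i)\<^sup>2)"
    using x by (simp add: scalar_prod_def sum_distrib_left power2_eq_square)
  also have "\<dots> \<le> (\<Sum>i = 0..<n. (A $$ (i, i) - S i) * (x $ i)\<^sup>2)"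
    using dom by (intro sum_mono mult_right_mono) (auto simp: S_def algebra_simps)
  also have "\<dots> = (\<Sum>i = 0..<n. \<Sum>j = 0..<n.
      (if i = j then A $$ (i, i) * (x $ i)\<^sup>2 else 0) - off i j * (((x $ i)\<^sup>2 + (x $ j)\<^sup>2) / 2))"
    unfolding sum_subtractf off_eq by (simp add: sum_subtractf left_diff_distrib)
  also have "\<dots> \<le> x \<bullet> (A *\<^sub>v x)"
    unfolding quad by (intro sum_mono bound) auto
  also have "\<dots> \<le> vec_norm2 x * vec_norm2 (A *\<^sub>v x)"
    using abs_scalar_prod_le[OF x, of "A *\<^sub>v x"] A x by auto
  finally have "vec_norm2 x * (l * vec_norm2 x) \<le> vec_norm2 x * vec_norm2 (A *\<^sub>v x)"
    by (simp add: mult_ac flip: vec_norm2_square power2_eq_square)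
  then show ?thesis
    using vec_norm2_nonneg[of x] by (cases "vec_norm2 x = 0") (auto simp: mult_le_cancel_left)
qed

text \<open>A lower bound on A forces a trivial kernel, hence a nonzero determinant; applying the
  bound to B x gives the norm bound of the inverse.\<close>

lemma ex_inverse_mat:
  fixes A :: "real mat"
  assumes A: "A \<in> carrier_mat n n" and c: "0 < c"
    and lb: "\<And>x. x \<in> carrier_vec n \<Longrightarrow> c * vec_norm2 x \<le> vec_norm2 (A *\<^sub>v x)"
  shows "\<exists>B. B \<in> carrier_mat n n \<and> A * B = 1\<^sub>m n \<and> B * A = 1\<^sub>m n \<and>
    (\<forall>x \<in> carrier_vec n. vec_norm2 (B *\<^sub>v x) \<le> (1 / c) * vec_norm2 x)"
proof -
  have "det A \<noteq> 0"
  proof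
    assume "det A = 0"
    then obtain v where v: "v \<in> carrier_vec n" "v \<noteq> 0\<^sub>v n" "A *\<^sub>v v = 0\<^sub>v n"
      using det_0_iff_vec_prod_zero_field[OF A] by auto
    have "c * vec_norm2 v \<le> 0"
      using lb[OF v(1)] v(3) by (simp add: vec_norm2_def)
    then have "vec_norm2 v = 0"
      using c vec_norm2_nonneg[of v] by (smt (verit) mult_pos_pos)
    then show False
      using v vec_norm2_eq_0_iff by blast
  qed
  then obtain B where B: "B \<in> carrier_mat n n" "A * B = 1\<^sub>m n" "B * A = 1\<^sub>m n"
    using det_non_zero_imp_unit[OF A, of "()"] by (auto simp: Units_def ring_mat_def)
  have "vec_norm2 (B *\<^sub>v x) \<le> (1 / c) * vec_norm2 x" if x: "x \<in> carrier_vec n" for x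
  proof -
    have "A *\<^sub>v (B *\<^sub>v x) = x"
      using A B x by (simp flip: assoc_mult_mat_vec)
    then show ?thesis
      using lb[of "B *\<^sub>v x"] B x c by (simp add: field_simps)
  qed
  with B show ?thesis
    by blast
qed

text \<open>A two-sided inverse excludes the result \<open>None\<close>, for which
  \<open>the\<close> would be unspecified; uniqueness of inverses does the rest.\<close>

lemma mat_inv_eq:
  assumes A: "A \<in> carrier_mat n n" and B: "B \<in> carrier_mat n n"
    and AB: "A * B = 1\<^sub>m n" "B * A = 1\<^sub>m n"
  shows "mat_inv A = B"
proof (cases "mat_inverse A")
  case None
  then have "A \<notin> Units (ring_mat TYPE(real) n ())"
    using mat_inverse(1)[OF A, of "()"] by blast
  then show ?thesis
    using assms by (auto simp: Units_def ring_mat_def)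
next
  case (Some X)
  then have X: "A * X = 1\<^sub>m n" "X \<in> carrier_mat n n"
    using mat_inverse(2)[OF A Some] by auto
  have "X = (B * A) * X"
    using X AB by simp
  also have "\<dots> = B * (A * X)"
    using A B X by (intro assoc_mult_mat) auto
  also have "\<dots> = B"
    using X B by simp
  finally show ?thesis
    using Some by (simp add: mat_inv_def)
qed

section \<open>Skew-symmetric block matrices\<close>

text \<open>The matrices \<open>\<omega>I + \<T>\<close>, \<open>\<omega>I + \<C>\<close>, \<open>\<omega>I \<plusminus> \<D>\<close>, \<open>\<R>\<close> and \<open>\<T> - \<C>\<close> all have this shape; for symmetric
  \<open>X\<close> the cross terms cancel in its Euclidean norm.\<close>
definition skew_block :: "nat \<Rightarrow> real \<Rightarrow> real mat \<Rightarrow> real mat" where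
  "skew_block n c X = four_block_mat (c \<cdot>\<^sub>m 1\<^sub>m n) X (- X) (c \<cdot>\<^sub>m 1\<^sub>m n)"

lemma skew_block_carrier [simp]:
  "X \<in> carrier_mat n n \<Longrightarrow> skew_block n c X \<in> carrier_mat (n + n) (n + n)"
  by (simp add: skew_block_def)

lemma skew_block_add:
  assumes "X \<in> carrier_mat n n" "Y \<in> carrier_mat n n"
  shows "skew_block n c X + skew_block n c' Y = skew_block n (c + c') (X + Y)"
  using assms by (intro eq_matI) (auto simp: skew_block_def)

lemma skew_block_diff:
  assumes "X \<in> carrier_mat n n" "Y \<in> carrier_mat n n"
  shows "skew_block n c X - skew_block n c' Y = skew_block n (c - c') (X - Y)"
  using assms by (intro eq_matI) (auto simp: skew_block_def)

lemma skew_block_mult_vec: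
  assumes "X \<in> carrier_mat n n" "p \<in> carrier_vec n" "q \<in> carrier_vec n"
  shows "skew_block n c X *\<^sub>v (p @\<^sub>v q) = (c \<cdot>\<^sub>v p + X *\<^sub>v q) @\<^sub>v (c \<cdot>\<^sub>v q - X *\<^sub>v p)"
proof -
  have "(c \<cdot>\<^sub>m 1\<^sub>m n) *\<^sub>v p = c \<cdot>\<^sub>v p" "(c \<cdot>\<^sub>m 1\<^sub>m n) *\<^sub>v q = c \<cdot>\<^sub>v q"
    using assms by (auto intro!: eq_vecI)
  moreover have "- X *\<^sub>v p + c \<cdot>\<^sub>v q = c \<cdot>\<^sub>v q - X *\<^sub>v p"
    using assms by (intro eq_vecI) auto
  ultimately show ?thesis
    unfolding skew_block_def using assms
    by (subst four_block_mat_mult_vec[of _ n n _ n _ n]) auto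
qed

lemma append_vec_cases:
  fixes x :: "real vec"
  assumes "x \<in> carrier_vec (n + n)"
  obtains p q where "p \<in> carrier_vec n" "q \<in> carrier_vec n" "x = p @\<^sub>v q"
  using vec_first_last_append[OF assms] by (metis vec_first_carrier vec_last_carrier)

lemma vec_norm2_append_square:
  assumes "p \<in> carrier_vec n" "q \<in> carrier_vec n"
  shows "(vec_norm2 (p @\<^sub>v q))\<^sup>2 = (vec_norm2 p)\<^sup>2 + (vec_norm2 q)\<^sup>2"
  unfolding vec_norm2_square by (rule scalar_prod_append[OF assms assms])

lemma vec_norm2_skew_block_square:
  assumes X: "X \<in> carrier_mat n n" "X\<^sup>T = X" and pq: "p \<in> carrier_vec n" "q \<in> carrier_vec n"
  shows "(vec_norm2 (skew_block n c X *\<^sub>v (p @\<^sub>v q)))\<^sup>2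
    = c\<^sup>2 * ((vec_norm2 p)\<^sup>2 + (vec_norm2 q)\<^sup>2) + ((vec_norm2 (X *\<^sub>v p))\<^sup>2 + (vec_norm2 (X *\<^sub>v q))\<^sup>2)"
proof -
  define u v where "u = X *\<^sub>v p" and "v = X *\<^sub>v q"
  have uv: "u \<in> carrier_vec n" "v \<in> carrier_vec n"
    using X pq by (auto simp: u_def v_def)
  have "p \<bullet> v = u \<bullet> q"
    using transpose_vec_mult_scalar[OF X(1) pq(2) pq(1)] X by (simp add: u_def v_def)
  then have pv: "(\<Sum>i = 0..<n. p $ i * v $ i) = (\<Sum>i = 0..<n. u $ i * q $ i)"
    using pq uv by (simp add: scalar_prod_def)
  have "(vec_norm2 (c \<cdot>\<^sub>v p + v))\<^sup>2 + (vec_norm2 (c \<cdot>\<^sub>v q - u))\<^sup>2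
      = (\<Sum>i = 0..<n. (c * p $ i + v $ i)\<^sup>2) + (\<Sum>i = 0..<n. (c * q $ i - u $ i)\<^sup>2)"
    using pq uv by (subst (1 2) vec_norm2_square_sum[of _ n]) auto
  also have "\<dots> = (\<Sum>i = 0..<n. c\<^sup>2 * (p $ i)\<^sup>2 + c\<^sup>2 * (q $ i)\<^sup>2 + (u $ i)\<^sup>2 + (v $ i)\<^sup>2
      + 2 * c * (p $ i * v $ i) - 2 * c * (u $ i * q $ i))"
    unfolding sum.distrib[symmetric] by (intro sum.cong) (auto simp: power2_eq_square algebra_simps)
  also have "\<dots> = c\<^sup>2 * (\<Sum>i = 0..<n. (p $ i)\<^sup>2) + c\<^sup>2 * (\<Sum>i = 0..<n. (q $ i)\<^sup>2)
      + (\<Sum>i = 0..<n. (u $ i)\<^sup>2) + (\<Sum>i = 0..<n. (v $ i)\<^sup>2)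
      + 2 * c * (\<Sum>i = 0..<n. p $ i * v $ i) - 2 * c * (\<Sum>i = 0..<n. u $ i * q $ i)"
    unfolding sum_subtractf sum.distrib sum_distrib_left ..
  also have "\<dots> = c\<^sup>2 * ((vec_norm2 p)\<^sup>2 + (vec_norm2 q)\<^sup>2) + ((vec_norm2 u)\<^sup>2 + (vec_norm2 v)\<^sup>2)"
    using pq uv by (simp add: pv vec_norm2_square_sum algebra_simps)
  finally show ?thesis
    using pq uv by (simp add: skew_block_mult_vec[OF X(1) pq] vec_norm2_append_square[of _ n] flip: u_def v_def)
qed

text \<open>With l = 0 this is the lower bound |c| for a multiple of the identity plus a
  skew-symmetric matrix; a positive l is supplied only for C.\<close>

lemma vec_norm2_skew_block_ge:
  assumes X: "X \<in> carrier_mat n n" "X\<^sup>T = X" and x: "x \<in> carrier_vec (n + n)" and l: "0 \<le> l"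
    and lb: "\<And>u. u \<in> carrier_vec n \<Longrightarrow> l * vec_norm2 u \<le> vec_norm2 (X *\<^sub>v u)"
  shows "sqrt (c\<^sup>2 + l\<^sup>2) * vec_norm2 x \<le> vec_norm2 (skew_block n c X *\<^sub>v x)"
proof -
  obtain p q where pq: "p \<in> carrier_vec n" "q \<in> carrier_vec n" "x = p @\<^sub>v q"
    using append_vec_cases[OF x] .
  have "l\<^sup>2 * (vec_norm2 u)\<^sup>2 \<le> (vec_norm2 (X *\<^sub>v u))\<^sup>2" if "u \<in> carrier_vec n" for u
    using power_mono[OF lb[OF that], of 2] l by (simp add: power_mult_distrib)
  from this[OF pq(1)] this[OF pq(2)]
  have "(c\<^sup>2 + l\<^sup>2) * ((vec_norm2 p)\<^sup>2 + (vec_norm2 q)\<^sup>2) \<le> (vec_norm2 (skew_block n c X *\<^sub>v x))\<^sup>2"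
    unfolding pq(3) vec_norm2_skew_block_square[OF X pq(1,2)] by (simp add: algebra_simps)
  then have "(sqrt (c\<^sup>2 + l\<^sup>2) * vec_norm2 x)\<^sup>2 \<le> (vec_norm2 (skew_block n c X *\<^sub>v x))\<^sup>2"
    using pq by (simp add: power_mult_distrib vec_norm2_append_square[OF pq(1,2)])
  then show ?thesis
    by (rule power2_le_imp_le) simp
qed

lemma vec_norm2_skew_block_le:
  assumes X: "X \<in> carrier_mat n n" "X\<^sup>T = X" and x: "x \<in> carrier_vec (n + n)"
    and ub: "\<And>u. u \<in> carrier_vec n \<Longrightarrow> vec_norm2 (X *\<^sub>v u) \<le> l * vec_norm2 u"
  shows "vec_norm2 (skew_block n c X *\<^sub>v x) \<le> sqrt (c\<^sup>2 + l\<^sup>2) * vec_norm2 x"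
proof -
  obtain p q where pq: "p \<in> carrier_vec n" "q \<in> carrier_vec n" "x = p @\<^sub>v q"
    using append_vec_cases[OF x] .
  have "(vec_norm2 (X *\<^sub>v u))\<^sup>2 \<le> l\<^sup>2 * (vec_norm2 u)\<^sup>2" if "u \<in> carrier_vec n" for u
    using power_mono[OF ub[OF that], of 2] by (simp add: power_mult_distrib)
  from this[OF pq(1)] this[OF pq(2)]
  have "(vec_norm2 (skew_block n c X *\<^sub>v x))\<^sup>2 \<le> (c\<^sup>2 + l\<^sup>2) * ((vec_norm2 p)\<^sup>2 + (vec_norm2 q)\<^sup>2)"
    unfolding pq(3) vec_norm2_skew_block_square[OF X pq(1,2)] by (simp add: algebra_simps)
  then have "(vec_norm2 (skew_block n c X *\<^sub>v x))\<^sup>2 \<le> (sqrt (c\<^sup>2 + l\<^sup>2) * vec_norm2 x)\<^sup>2"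
    using pq by (simp add: power_mult_distrib vec_norm2_append_square[OF pq(1,2)])
  then show ?thesis
    by (rule power2_le_imp_le) simp
qed

section \<open>Rank\<close>

text \<open>Rank depends on the column space only, so it can be read off from an injective K with
  the same range, whose columns are a basis.\<close>

lemma mat_rank_eq_col_space:
  assumes A: "A \<in> carrier_mat n m" and K: "K \<in> carrier_mat n r"
    and range: "\<And>x. x \<in> carrier_vec m \<Longrightarrow> \<exists>y \<in> carrier_vec r. A *\<^sub>v x = K *\<^sub>v y"
      "\<And>y. y \<in> carrier_vec r \<Longrightarrow> \<exists>x \<in> carrier_vec m. K *\<^sub>v y = A *\<^sub>v x"
    and inj: "\<And>y. y \<in> carrier_vec r \<Longrightarrow> K *\<^sub>v y = 0\<^sub>v n \<Longrightarrow> y = 0\<^sub>v r"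
  shows "mat_rank A = r"
proof -
  interpret V: vec_space "TYPE(real)" n .
  \<comment> \<open>Independence is stated for the set of columns, in which equal columns would
    merge. Two equal ones would put the difference of two unit vectors into the kernel of K.\<close>
  have dist: "distinct (cols K)"
  proof (rule ccontr)
    assume "\<not> distinct (cols K)"
    then obtain i j where ij: "i < r" "j < r" "i \<noteq> j" "col K i = col K j"
      using K by (auto simp: distinct_conv_nth)
    have unit: "K *\<^sub>v unit_vec r l = col K l" if "l < r" for l
      using K that by (intro eq_vecI) auto
    have "K *\<^sub>v (unit_vec r i - unit_vec r j) = K *\<^sub>v unit_vec r i - K *\<^sub>v unit_vec r j"
      using K by (intro mult_minus_distrib_mat_vec) auto
    also have "\<dots> = 0\<^sub>v n"
      using K ij by (simp add: unit)
    finally have "unit_vec r i - unit_vec r j = (0\<^sub>v r :: real vec)"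
      by (intro inj) auto
    then have "(unit_vec r i - unit_vec r j :: real vec) $ i = 0"
      using ij by simp
    then show False
      using ij by simp
  qed
  moreover have "V.lin_indpt (set (cols K))"
    using V.lin_depE[OF K _ dist] inj by metis
  ultimately have "V.rank K = r"
    using K by (intro V.lin_indpt_full_rank)
  moreover have "V.col_space A = V.col_space K"
    unfolding V.col_space_eq[OF A] V.col_space_eq[OF K] using A K range by auto metis+
  ultimately show ?thesis
    using A by (simp add: mat_rank_def V.rank_def V.col_space_def)
qed

text \<open>The range of B is the image of the vectors supported on J, on which B is injective; a
  surjective N on the right leaves that range unchanged.\<close>

lemma mat_rank_mult_invertible:
  assumes B: "B \<in> carrier_mat n m"
    and N: "N \<in> carrier_mat m m" "N' \<in> carrier_mat m m" "N * N' = 1\<^sub>m m"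
    and J: "J \<subseteq> {..<m}"
    and zero: "\<And>x. x \<in> carrier_vec m \<Longrightarrow> (\<And>j. j \<in> J \<Longrightarrow> x $ j = 0) \<Longrightarrow> B *\<^sub>v x = 0\<^sub>v n"
    and inj: "\<And>x. x \<in> carrier_vec m \<Longrightarrow> (\<And>j. j < m \<Longrightarrow> j \<notin> J \<Longrightarrow> x $ j = 0) \<Longrightarrow>
      B *\<^sub>v x = 0\<^sub>v n \<Longrightarrow> x = 0\<^sub>v m"
  shows "mat_rank (B * N) = card J"
proof -
  define r where "r = card J"
  have "finite J"
    using J finite_subset by blast
  then obtain \<sigma> where \<sigma>: "bij_betw \<sigma> {0..<r} J"
    using ex_bij_betw_nat_finite unfolding r_def by blast
  \<comment> \<open>\<open>S\<close> places r coordinates at the positions in J and zeros elsewhere,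
    so \<open>B * S\<close> consists of the columns of B indexed by J.\<close>
  define S :: "real mat" where "S = mat m r (\<lambda>(i, l). if i = \<sigma> l then 1 else 0)"
  have S: "S \<in> carrier_mat m r"
    by (simp add: S_def)
  have \<sigma>J: "\<sigma> l \<in> J" "\<sigma> l < m" if "l < r" for l
    using bij_betwE[OF \<sigma>] that J by auto
  have S_in: "(S *\<^sub>v y) $ \<sigma> l = y $ l" if y: "y \<in> carrier_vec r" and l: "l < r" for y l
  proof -
    have "(S *\<^sub>v y) $ \<sigma> l = (\<Sum>k = 0..<r. (if \<sigma> l = \<sigma> k then 1 else 0) * y $ k)"
      using y \<sigma>J[OF l] by (simp add: S_def scalar_prod_def)
    also have "\<dots> = (\<Sum>k = 0..<r. if k = l then y $ k else 0)"
      using \<sigma> l by (intro sum.cong) (auto simp: bij_betw_def inj_on_def)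
    also have "\<dots> = y $ l"
      using l by simp
    finally show ?thesis .
  qed
  have S_out: "(S *\<^sub>v y) $ j = 0" if y: "y \<in> carrier_vec r" and "j < m" "j \<notin> J" for y j
  proof -
    have "(S *\<^sub>v y) $ j = (\<Sum>k = 0..<r. (if j = \<sigma> k then 1 else 0) * y $ k)"
      using y that by (simp add: S_def scalar_prod_def)
    also have "\<dots> = 0"
      using that \<sigma>J by (intro sum.neutral) auto
    finally show ?thesis .
  qed
  have BS: "B * S \<in> carrier_mat n r"
    using B S by simp
  have "mat_rank (B * N) = r"
  proof (rule mat_rank_eq_col_space[OF _ BS])
    show "B * N \<in> carrier_mat n m"
      using B N by simp
  next
    fix x :: "real vec"
    assume x: "x \<in> carrier_vec m"
    define w where "w = N *\<^sub>v x"
    \<comment> \<open>The entries of \<open>w\<close> on J; the remainder \<open>w - S y\<close>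
      vanishes on J and is annihilated by B.\<close>
    define y where "y = vec r (\<lambda>l. w $ \<sigma> l)"
    have wy: "w \<in> carrier_vec m" "y \<in> carrier_vec r" "S *\<^sub>v y \<in> carrier_vec m"
      using N x S by (auto simp: w_def y_def)
    have "B *\<^sub>v (w - S *\<^sub>v y) = 0\<^sub>v n"
    proof (rule zero)
      show "w - S *\<^sub>v y \<in> carrier_vec m"
        using wy by simp
      fix j assume "j \<in> J"
      then obtain l where l: "l < r" "j = \<sigma> l"
        using \<sigma> by (auto simp: bij_betw_def)
      then show "(w - S *\<^sub>v y) $ j = 0"
        using wy \<sigma>J[OF l(1)] S_in[OF wy(2) l(1)] S by (simp add: y_def)
    qed
    moreover have "B *\<^sub>v (w - S *\<^sub>v y) = B *\<^sub>v w - B *\<^sub>v (S *\<^sub>v y)"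
      using B wy by (intro mult_minus_distrib_mat_vec)
    ultimately have diff: "B *\<^sub>v w - B *\<^sub>v (S *\<^sub>v y) = 0\<^sub>v n"
      by simp
    have "B *\<^sub>v w = B *\<^sub>v (S *\<^sub>v y)"
    proof (rule eq_vecI)
      fix i assume "i < dim_vec (B *\<^sub>v (S *\<^sub>v y))"
      then show "(B *\<^sub>v w) $ i = (B *\<^sub>v (S *\<^sub>v y)) $ i"
        using arg_cong[OF diff, of "\<lambda>v. vec_index v i"] B by simp
    qed simp
    then have "(B * N) *\<^sub>v x = (B * S) *\<^sub>v y"
      using B N S x wy by (simp add: w_def)
    then show "\<exists>y \<in> carrier_vec r. (B * N) *\<^sub>v x = (B * S) *\<^sub>v y"
      using wy by blast
  next
    fix y :: "real vec"
    assume y: "y \<in> carrier_vec r"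
    define x where "x = N' *\<^sub>v (S *\<^sub>v y)"
    have x: "x \<in> carrier_vec m" "S *\<^sub>v y \<in> carrier_vec m"
      using N S y by (auto simp: x_def)
    have "N *\<^sub>v x = (N * N') *\<^sub>v (S *\<^sub>v y)"
      unfolding x_def using N x(2) by (intro assoc_mult_mat_vec[symmetric])
    then have "N *\<^sub>v x = S *\<^sub>v y"
      using N x by simp
    then have "(B * S) *\<^sub>v y = (B * N) *\<^sub>v x"
      using B N S x y by simp
    then show "\<exists>x \<in> carrier_vec m. (B * S) *\<^sub>v y = (B * N) *\<^sub>v x"
      using x by blast
  next
    fix y :: "real vec"
    assume y: "y \<in> carrier_vec r" "(B * S) *\<^sub>v y = 0\<^sub>v n"
    have Sy: "S *\<^sub>v y = 0\<^sub>v m"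
      using B S y S_out[OF y(1)] by (intro inj) auto
    show "y = 0\<^sub>v r"
    proof (rule eq_vecI)
      fix l assume "l < dim_vec (0\<^sub>v r :: real vec)"
      then show "y $ l = 0\<^sub>v r $ l"
        using S_in[OF y(1), of l] \<sigma>J[of l] Sy by simp
    qed (use y in auto)
  qed
  then show ?thesis
    by (simp add: r_def)
qed

section \<open>Symmetric Toeplitz matrices\<close>

text \<open>Depending on the distance |i - j| only, this form covers T, since c is even, and C,
  since its coefficients are symmetric under m to M - m. Splitting T - C then means splitting one
  function of the distance.\<close>

definition sym_toeplitz :: "nat \<Rightarrow> (nat \<Rightarrow> real) \<Rightarrow> real mat" where
  "sym_toeplitz n f = mat n n (\<lambda>(i, j). f (nat \<bar>int i - int j\<bar>))"

lemma sym_toeplitz_carrier [simp]: "sym_toeplitz n f \<in> carrier_mat n n"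
  by (simp add: sym_toeplitz_def)

lemma sym_toeplitz_index:
  "i < n \<Longrightarrow> j < n \<Longrightarrow> sym_toeplitz n f $$ (i, j) = f (nat \<bar>int i - int j\<bar>)"
  by (simp add: sym_toeplitz_def)

lemma transpose_sym_toeplitz: "(sym_toeplitz n f)\<^sup>T = sym_toeplitz n f"
  by (intro eq_matI) (auto simp: sym_toeplitz_def abs_minus_commute)

lemma sym_toeplitz_add:
  "sym_toeplitz n f + sym_toeplitz n g = sym_toeplitz n (\<lambda>m. f m + g m)"
  by (intro eq_matI) (auto simp: sym_toeplitz_def)

lemma sym_toeplitz_cong:
  assumes "\<And>m. m < n \<Longrightarrow> f m = g m"
  shows "sym_toeplitz n f = sym_toeplitz n g"
  using assms by (intro eq_matI) (auto simp: sym_toeplitz_def)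

lemma sym_toeplitz_mult_vec:
  assumes "x \<in> carrier_vec n" "i < n"
  shows "(sym_toeplitz n f *\<^sub>v x) $ i = (\<Sum>j = 0..<n. f (nat \<bar>int i - int j\<bar>) * x $ j)"
  using assms by (auto simp: sym_toeplitz_def scalar_prod_def intro!: sum.cong)

text \<open>In each row, distances of at least half the size occur on one side of the diagonal only.\<close>
lemma sym_toeplitz_far_row_sum:
  assumes zero: "\<And>m. 2 * m < n \<Longrightarrow> f m = 0" and i: "i < n"
  shows "(\<Sum>j = 0..<n. \<bar>sym_toeplitz n f $$ (i, j)\<bar>) \<le> (\<Sum>m = 1..n div 2. \<bar>f (n - m)\<bar>)"
proof -
  define \<delta> where "\<delta> j = nat \<bar>int i - int j\<bar>" for j
  define J where "J = {j \<in> {0..<n}. n \<le> 2 * \<delta> j}"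
  have "(\<Sum>j = 0..<n. \<bar>sym_toeplitz n f $$ (i, j)\<bar>) = (\<Sum>j = 0..<n. \<bar>f (\<delta> j)\<bar>)"
    using i by (intro sum.cong) (auto simp: sym_toeplitz_index \<delta>_def)
  also have "\<dots> = (\<Sum>j \<in> J. \<bar>f (\<delta> j)\<bar>)"
    using zero by (intro sum.mono_neutral_right) (auto simp: J_def not_le)
  also have "\<dots> = (\<Sum>j \<in> J. \<bar>f (n - (n - \<delta> j))\<bar>)"
    using i by (intro sum.cong) (auto simp: J_def \<delta>_def)
  also have "\<dots> = (\<Sum>m \<in> (\<lambda>j. n - \<delta> j) ` J. \<bar>f (n - m)\<bar>)"
  proof (subst sum.reindex)
    show "inj_on (\<lambda>j. n - \<delta> j) J"
      using i by (intro inj_onI) (auto simp: J_def \<delta>_def nat_eq_iff2 abs_if split: if_splits)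
  qed simp
  also have "\<dots> \<le> (\<Sum>m = 1..n div 2. \<bar>f (n - m)\<bar>)"
    using i by (intro sum_mono2) (auto simp: J_def \<delta>_def)
  finally show ?thesis .
qed

lemma sym_toeplitz_circulant_row_sum:
  assumes per: "\<And>m. 0 < m \<Longrightarrow> m < n \<Longrightarrow> f (n - m) = f m" and i: "i < n"
  shows "(\<Sum>j \<in> {0..<n} - {i}. \<bar>sym_toeplitz n f $$ (i, j)\<bar>) = (\<Sum>m = 1..<n. \<bar>f m\<bar>)"
proof -
  \<comment> \<open>The map j to (i - j) mod n, an involution, so it serves as both directions of
    the reindexing; the omitted j = i would go to 0.\<close>
  define \<phi> where "\<phi> j = (if j \<le> i then i - j else n + i - j)" for j
  show ?thesis
  proof (rule sum.reindex_bij_witness[of _ \<phi> \<phi>])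
    fix j assume "j \<in> {0..<n} - {i}"
    then show "\<bar>f (\<phi> j)\<bar> = \<bar>sym_toeplitz n f $$ (i, j)\<bar>"
      using i per[of "j - i"] by (auto simp: \<phi>_def sym_toeplitz_index nat_diff_distrib)
  qed (use i in \<open>auto simp: \<phi>_def\<close>)
qed

section \<open>Kernel and injectivity of the two triangular corners\<close>

definition outer_indices :: "nat \<Rightarrow> nat \<Rightarrow> nat set" where
  "outer_indices n k = {0..<k} \<union> {n - k..<n}"

lemma card_outer_indices: "2 * k \<le> n \<Longrightarrow> card (outer_indices n k) = 2 * k"
  unfolding outer_indices_def by (subst card_Un_disjoint) auto

text \<open>Entries at distance at least n - k from the diagonal lie in the first k or the last k
  columns.\<close>

lemma corner_mult_vec_eq_0:
  assumes f: "\<And>m. m < n - k \<Longrightarrow> f m = 0"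
    and x: "x \<in> carrier_vec n" "\<And>j. j \<in> outer_indices n k \<Longrightarrow> x $ j = 0"
  shows "sym_toeplitz n f *\<^sub>v x = 0\<^sub>v n"
proof (rule eq_vecI)
  fix i assume "i < dim_vec (0\<^sub>v n :: real vec)"
  then have i: "i < n" by simp
  have "f (nat \<bar>int i - int j\<bar>) * x $ j = 0" if "j < n" for j
  proof (cases "nat \<bar>int i - int j\<bar> < n - k")
    case False
    then have "j \<in> outer_indices n k"
      using i that by (auto simp: outer_indices_def)
    then show ?thesis
      by (simp add: x)
  qed (simp add: f)
  then show "(sym_toeplitz n f *\<^sub>v x) $ i = 0\<^sub>v n $ i"
    using i x(1) by (subst sym_toeplitz_mult_vec) (auto intro!: sum.neutral)
qed (simp add: sym_toeplitz_def)

text \<open>The two corners are triangular with nonzero diagonal, so back substitution applies.\<close>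
lemma corner_mult_vec_inj:
  assumes f: "\<And>m. m < n - k \<Longrightarrow> f m = 0" "f (n - k) \<noteq> 0" and k: "2 * k \<le> n"
    and x: "x \<in> carrier_vec n" "\<And>j. j < n \<Longrightarrow> j \<notin> outer_indices n k \<Longrightarrow> x $ j = 0"
    and eq: "sym_toeplitz n f *\<^sub>v x = 0\<^sub>v n"
  shows "x = 0\<^sub>v n"
proof -
  have row: "(\<Sum>j = 0..<n. f (nat \<bar>int i - int j\<bar>) * x $ j) = 0" if "i < n" for i
    using sym_toeplitz_mult_vec[OF x(1) that, of f] that by (simp add: eq)
  have solve: "x $ j = 0"
    if i: "i < n" "j < n" "nat \<bar>int i - int j\<bar> = n - k"
      and other: "\<And>j'. j' < n \<Longrightarrow> j' \<noteq> j \<Longrightarrow> n - k \<le> nat \<bar>int i - int j'\<bar> \<Longrightarrow> x $ j' = 0" for i j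
  proof -
    have "0 = (\<Sum>j' = 0..<n. f (nat \<bar>int i - int j'\<bar>) * x $ j')"
      using row[OF i(1)] by simp
    also have "\<dots> = (\<Sum>j' = 0..<n. if j' = j then f (n - k) * x $ j else 0)"
    proof (intro sum.cong refl)
      fix j' assume "j' \<in> {0..<n}"
      then show "f (nat \<bar>int i - int j'\<bar>) * x $ j' = (if j' = j then f (n - k) * x $ j else 0)"
        using other[of j'] f(1)[of "nat \<bar>int i - int j'\<bar>"] i(3) by (cases "j' = j") (auto simp: not_less[symmetric])
    qed
    also have "\<dots> = f (n - k) * x $ j"
      using i by simp
    finally show ?thesis
      using f(2) by simp
  qed
  have low: "x $ j = 0" if "j < k" for j
    using that
  proof (induction j rule: less_induct)
    case (less j)
    show ?case
    \<comment> \<open>In this row column j sits at distance exactly n - k, and because 2k \<le> n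
      the only columns at least as far are those with smaller index, already solved.\<close>
    proof (rule solve[of "j + (n - k)"])
      fix j' assume "j' < n" "j' \<noteq> j" "n - k \<le> nat \<bar>int (j + (n - k)) - int j'\<bar>"
      then have "j' < j"
        using k less.prems by (auto simp: abs_if split: if_splits)
      then show "x $ j' = 0"
        using less by simp
    qed (use k less.prems in auto)
  qed
  \<comment> \<open>The mirror image, counted from the last column: row k - 1 - l meets column n - 1
    - l at distance n - k.\<close>
  have high: "x $ (n - Suc l) = 0" if "l < k" for l
    using that
  proof (induction l rule: less_induct)
    case (less l)
    show ?case
    proof (rule solve[of "k - Suc l"])
      fix j' assume j': "j' < n" "j' \<noteq> n - Suc l" "n - k \<le> nat \<bar>int (k - Suc l) - int j'\<bar>"
      then have "n - Suc j' < l" "j' = n - Suc (n - Suc j')"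
        using k less.prems by (auto simp: abs_if split: if_splits)
      then show "x $ j' = 0"
        using less.IH[of "n - Suc j'"] less.prems by simp
    qed (use k less.prems in auto)
  qed
  show ?thesis
  proof (rule eq_vecI)
    fix j assume "j < dim_vec (0\<^sub>v n :: real vec)"
    then show "x $ j = 0\<^sub>v n $ j"
      using low[of j] high[of "n - Suc j"] x(2)[of j] by (force simp: outer_indices_def)
  qed (use x in auto)
qed

section \<open>Perturbation of the preconditioner\<close>

text \<open>The resolvent identity, obtained by inserting \<open>X * X'\<close> after
  \<open>Y'\<close>. The inverse \<open>X'\<close> stands on the right, where it will meet
  \<R>.\<close>

lemma inverse_perturbation:
  fixes X Y A B X' Y' :: "real mat"
  assumes "X \<in> carrier_mat n n" "Y \<in> carrier_mat n n" "A \<in> carrier_mat n n" "B \<in> carrier_mat n n"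
    "X' \<in> carrier_mat n n" "Y' \<in> carrier_mat n n"
    and inv: "X * X' = 1\<^sub>m n" "Y' * Y = 1\<^sub>m n" and X: "X = Y + (A + B)"
  shows "Y' = X' + (Y' * A * X' + Y' * B * X')"
proof -
  have "Y' = Y' * (X * X')"
    using assms by simp
  also have "\<dots> = (Y' * X) * X'"
    using assms by (intro assoc_mult_mat[symmetric])
  also have "Y' * X = Y' * Y + (Y' * A + Y' * B)"
    unfolding X using assms(1-6) by (simp add: mult_add_distrib_mat[of _ n n _ n])
  also have "(Y' * Y + (Y' * A + Y' * B)) * X' = X' + (Y' * A * X' + Y' * B * X')"
    unfolding inv using assms(1-6) by (simp add: add_mult_distrib_mat[of _ n n _ _ n])
  finally show ?thesis .
qed

lemma mat_inv_precond:
  assumes "X \<in> carrier_mat n n" "W \<in> carrier_mat n n" "X' \<in> carrier_mat n n" "W' \<in> carrier_mat n n"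
    and inv: "X * X' = 1\<^sub>m n" "X' * X = 1\<^sub>m n" "W * W' = 1\<^sub>m n" "W' * W = 1\<^sub>m n"
    and \<omega>: "0 < \<omega>"
  shows "mat_inv ((1 / (2 * \<omega>)) \<cdot>\<^sub>m (X * W)) = 2 * \<omega> \<cdot>\<^sub>m (W' * X')"
proof (rule mat_inv_eq[of _ n])
  have scale: "2 * \<omega> \<cdot>\<^sub>m ((1 / (2 * \<omega>)) \<cdot>\<^sub>m 1\<^sub>m n) = (1\<^sub>m n :: real mat)"
    "(1 / (2 * \<omega>)) \<cdot>\<^sub>m (2 * \<omega> \<cdot>\<^sub>m 1\<^sub>m n) = (1\<^sub>m n :: real mat)"
    using \<omega> by (auto intro!: eq_matI)
  have "(X * W) * (W' * X') = X * ((W * W') * X')"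
    using assms(1-4) by (simp add: assoc_mult_mat[of _ n n _ n _ n])
  also have "\<dots> = 1\<^sub>m n"
    using assms(1-4) inv by simp
  finally show "(1 / (2 * \<omega>)) \<cdot>\<^sub>m (X * W) * (2 * \<omega> \<cdot>\<^sub>m (W' * X')) = 1\<^sub>m n"
    using assms(1-4) \<omega> by (simp add: mult_smult_distrib[of _ n n _ n] mult_smult_assoc_mat[of _ n n _ n] scale)
  have "(W' * X') * (X * W) = W' * ((X' * X) * W)"
    using assms(1-4) by (simp add: assoc_mult_mat[of _ n n _ n _ n])
  also have "\<dots> = 1\<^sub>m n"
    using assms(1-4) inv by simp
  finally show "(2 * \<omega> \<cdot>\<^sub>m (W' * X')) * ((1 / (2 * \<omega>)) \<cdot>\<^sub>m (X * W)) = 1\<^sub>m n"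
    using assms(1-4) \<omega> by (simp add: mult_smult_distrib[of _ n n _ n] mult_smult_assoc_mat[of _ n n _ n] scale)
qed (use assms(1-4) in auto)

text \<open>With c = 0 the block matrix sends (p, q) to (A q, -A p), so what A does with J passes to
  two shifted copies of J. This doubling turns 2k into rank 4k.\<close>

lemma skew_block_mult_vec_eq_0:
  fixes x :: "real vec"
  assumes "A \<in> carrier_mat n n" "J \<subseteq> {..<n}"
    and zero: "\<And>p. p \<in> carrier_vec n \<Longrightarrow> (\<And>j. j \<in> J \<Longrightarrow> p $ j = 0) \<Longrightarrow> A *\<^sub>v p = 0\<^sub>v n"
  assumes x: "x \<in> carrier_vec (n + n)" "\<And>j. j \<in> J \<union> (+) n ` J \<Longrightarrow> x $ j = 0"
  shows "skew_block n 0 A *\<^sub>v x = 0\<^sub>v (n + n)"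
proof -
  obtain p q where pq: "p \<in> carrier_vec n" "q \<in> carrier_vec n" "x = p @\<^sub>v q"
    using append_vec_cases[OF x(1)] .
  have "p $ j = 0" "q $ j = 0" if "j \<in> J" for j
  proof -
    have "j < n" using assms(2) that by auto
    then show "p $ j = 0" "q $ j = 0"
      using x(2)[of j] x(2)[of "n + j"] that pq by auto
  qed
  then have "A *\<^sub>v p = 0\<^sub>v n" "A *\<^sub>v q = 0\<^sub>v n"
    using zero pq by blast+
  then show ?thesis
    unfolding pq(3) skew_block_mult_vec[OF assms(1) pq(1,2)] using pq by (intro eq_vecI) auto
qed

lemma skew_block_inj_on_support:
  fixes x :: "real vec"
  assumes "A \<in> carrier_mat n n"
    and inj: "\<And>p. p \<in> carrier_vec n \<Longrightarrow> (\<And>j. j < n \<Longrightarrow> j \<notin> J \<Longrightarrow> p $ j = 0) \<Longrightarrow>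
      A *\<^sub>v p = 0\<^sub>v n \<Longrightarrow> p = 0\<^sub>v n"
    and x: "x \<in> carrier_vec (n + n)" "\<And>j. j < n + n \<Longrightarrow> j \<notin> J \<union> (+) n ` J \<Longrightarrow> x $ j = 0"
    and J: "J \<subseteq> {..<n}"
    and eq: "skew_block n 0 A *\<^sub>v x = 0\<^sub>v (n + n)"
  shows "x = 0\<^sub>v (n + n)"
proof -
  obtain p q where pq: "p \<in> carrier_vec n" "q \<in> carrier_vec n" "x = p @\<^sub>v q"
    using append_vec_cases[OF x(1)] .
  have supp: "p $ j = 0" "q $ j = 0" if "j < n" "j \<notin> J" for j
    using x(2)[of j] x(2)[of "n + j"] that pq J by force+
  have eq': "(0 \<cdot>\<^sub>v p + A *\<^sub>v q) @\<^sub>v (0 \<cdot>\<^sub>v q - A *\<^sub>v p) = 0\<^sub>v (n + n)"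
    using eq unfolding pq(3) skew_block_mult_vec[OF assms(1) pq(1,2)] .
  have "(A *\<^sub>v q) $ i = 0 \<and> (A *\<^sub>v p) $ i = 0" if "i < n" for i
    using arg_cong[OF eq', of "\<lambda>v. vec_index v i"] arg_cong[OF eq', of "\<lambda>v. vec_index v (n + i)"]
      that pq assms(1) by simp
  then have "A *\<^sub>v p = 0\<^sub>v n" "A *\<^sub>v q = 0\<^sub>v n"
    using assms(1) by (auto intro!: eq_vecI)
  then have "p = 0\<^sub>v n" "q = 0\<^sub>v n"
    using inj supp pq by blast+
  then show ?thesis
    unfolding pq(3) by (intro eq_vecI) auto
qed

lemma mult_mat_vec_eq_0_cancel:
  fixes A :: "real mat"
  assumes "A \<in> carrier_mat n n" "B \<in> carrier_mat n n" "B * A = 1\<^sub>m n" "x \<in> carrier_vec n"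
    "A *\<^sub>v x = 0\<^sub>v n"
  shows "x = 0\<^sub>v n"
proof -
  have "x = (B * A) *\<^sub>v x"
    using assms(4) unfolding assms(3) by simp
  also have "\<dots> = B *\<^sub>v (A *\<^sub>v x)"
    by (rule assoc_mult_mat_vec[OF assms(2,1,4)])
  also have "\<dots> = B *\<^sub>v 0\<^sub>v n"
    using assms by simp
  also have "\<dots> = 0\<^sub>v n"
    using assms(2) by (intro eq_vecI) auto
  finally show ?thesis .
qed

text \<open>The linear algebra separated from the coefficients. In \<open>\<kappa>\<close> the 2 is
  2\<omega> times the bound 1/\<omega> for (\<omega>I + \<D>)^(-1), the root bounds the inverse of
  \<omega>I + \<C>, and the bracket bounds (\<omega>I + \<T>)^(-1) \<R>. The terms \<omega> + 1
  arise because \<T> and \<C> carry identity blocks of their own.\<close>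

lemma preconditioner_perturbation:
  fixes T C D A B :: "real mat" and M :: nat
  assumes M: "0 < M" and \<omega>: "0 < \<omega>" and \<nu>: "0 \<le> \<nu>" and l: "0 \<le> l" and ab: "0 \<le> \<beta>\<^sub>A" "0 \<le> \<beta>\<^sub>B"
    and carrier: "T \<in> carrier_mat M M" "C \<in> carrier_mat M M" "D \<in> carrier_mat M M"
      "A \<in> carrier_mat M M" "B \<in> carrier_mat M M"
    and sym: "T\<^sup>T = T" "C\<^sup>T = C" "D\<^sup>T = D" "A\<^sup>T = A" "B\<^sup>T = B"
    and T: "T = C + (A + B)"
    and C_ge: "\<And>u. u \<in> carrier_vec M \<Longrightarrow> l * vec_norm2 u \<le> vec_norm2 (C *\<^sub>v u)"
    and D_le: "\<And>u. u \<in> carrier_vec M \<Longrightarrow> vec_norm2 (D *\<^sub>v u) \<le> \<nu> * vec_norm2 u"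
    and A_le: "\<And>u. u \<in> carrier_vec M \<Longrightarrow> vec_norm2 (A *\<^sub>v u) \<le> \<beta>\<^sub>A * vec_norm2 u"
    and B_le: "\<And>u. u \<in> carrier_vec M \<Longrightarrow> vec_norm2 (B *\<^sub>v u) \<le> \<beta>\<^sub>B * vec_norm2 u"
    and J: "J \<subseteq> {..<M}"
    and zero: "\<And>u. u \<in> carrier_vec M \<Longrightarrow> (\<And>j. j \<in> J \<Longrightarrow> u $ j = 0) \<Longrightarrow> A *\<^sub>v u = 0\<^sub>v M"
    and inj: "\<And>u. u \<in> carrier_vec M \<Longrightarrow> (\<And>j. j < M \<Longrightarrow> j \<notin> J \<Longrightarrow> u $ j = 0) \<Longrightarrow>
      A *\<^sub>v u = 0\<^sub>v M \<Longrightarrow> u = 0\<^sub>v M"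
  defines "R \<equiv> four_block_mat (1\<^sub>m M) (T - D) (D - T) (1\<^sub>m M)"
  defines "\<kappa> \<equiv> 2 * (1 + sqrt (\<omega>\<^sup>2 + \<nu>\<^sup>2) / (\<omega> + 1)) / sqrt ((\<omega> + 1)\<^sup>2 + l\<^sup>2)"
  shows "\<exists>P Q. P \<in> carrier_mat (2 * M) (2 * M) \<and> Q \<in> carrier_mat (2 * M) (2 * M)
    \<and> mat_inv (precond (2 * M) \<omega> (blk_IX M C) (blk_D M D)) * R
      = mat_inv (precond (2 * M) \<omega> (blk_IX M T) (blk_D M D)) * R + P + Q
    \<and> mat_rank P = 2 * card J
    \<and> mat_norm2 P \<le> \<kappa> * \<beta>\<^sub>A \<and> mat_norm2 Q \<le> \<kappa> * \<beta>\<^sub>B"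
proof -
  define N where "N = M + M"
  have N: "2 * M = N" "0 < N"
    using M by (auto simp: N_def)
  define X where "X = skew_block M (\<omega> + 1) T"
  define Y where "Y = skew_block M (\<omega> + 1) C"
  \<comment> \<open>Signs: \<open>blk_D\<close> has -D in its upper right block, so \<open>W\<close>
    is \<omega>I + \<D> and \<open>Z\<close> is \<omega>I - \<D>, which gives \<R> = X - Z.\<close>
  define W where "W = skew_block M \<omega> (- D)"
  define Z where "Z = skew_block M \<omega> D"
  define KA where "KA = skew_block M 0 A"
  define KB where "KB = skew_block M 0 B"
  define s where "s = sqrt ((\<omega> + 1)\<^sup>2 + l\<^sup>2)"
  define t where "t = sqrt (\<omega>\<^sup>2 + \<nu>\<^sup>2)"
  have \<omega>1: "0 < \<omega> + 1"
    using \<omega> by simp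
  have s: "0 < s"
    using \<omega> by (auto simp: s_def intro!: add_pos_nonneg)
  have mats: "X \<in> carrier_mat N N" "Y \<in> carrier_mat N N" "W \<in> carrier_mat N N" "Z \<in> carrier_mat N N"
    "KA \<in> carrier_mat N N" "KB \<in> carrier_mat N N"
    using carrier by (auto simp: N_def X_def Y_def W_def Z_def KA_def KB_def)
  have R_block: "R = skew_block M 1 (T - D)"
    using carrier unfolding R_def skew_block_def
    by (intro arg_cong3[of _ _ _ _ _ _ "\<lambda>a b c. four_block_mat a b c a"] eq_matI) auto
  then have R: "R \<in> carrier_mat N N"
    using skew_block_carrier[OF minus_carrier_mat[OF carrier(3)]] by (simp add: N_def)
  have blk_IX: "\<omega> \<cdot>\<^sub>m 1\<^sub>m N + blk_IX M V = skew_block M (\<omega> + 1) V" if "V \<in> carrier_mat M M" for V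
    using that unfolding N_def by (intro eq_matI) (auto simp: blk_IX_def skew_block_def)
  have blk_D: "\<omega> \<cdot>\<^sub>m 1\<^sub>m N + blk_D M D = W"
    using carrier unfolding N_def W_def by (intro eq_matI) (auto simp: blk_D_def skew_block_def)
  have X_eq: "X = Y + (KA + KB)"
    unfolding X_def Y_def KA_def KB_def T using carrier by (simp add: skew_block_add)
  have R_eq: "R = X - Z"
    unfolding R_block X_def Z_def using carrier by (simp add: skew_block_diff)
  have sym': "(- D)\<^sup>T = - D" "(T - D)\<^sup>T = T - D"
    using carrier sym transpose_minus[of T M M D] by (auto simp: transpose_uminus)
  have X_ge: "(\<omega> + 1) * vec_norm2 x \<le> vec_norm2 (X *\<^sub>v x)" if "x \<in> carrier_vec N" for x
    using vec_norm2_skew_block_ge[OF carrier(1) sym(1), of x 0 "\<omega> + 1"] that \<omega>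
    by (simp add: X_def N_def)
  have Y_ge: "s * vec_norm2 x \<le> vec_norm2 (Y *\<^sub>v x)" if "x \<in> carrier_vec N" for x
    using vec_norm2_skew_block_ge[OF carrier(2) sym(2) _ l C_ge, of x "\<omega> + 1"] that
    by (simp add: Y_def N_def s_def)
  have W_ge: "\<omega> * vec_norm2 x \<le> vec_norm2 (W *\<^sub>v x)" if "x \<in> carrier_vec N" for x
    using vec_norm2_skew_block_ge[of "- D" M x 0 \<omega>] carrier sym' that \<omega>
    by (simp add: W_def N_def)
  have R_ge: "1 * vec_norm2 x \<le> vec_norm2 (R *\<^sub>v x)" if "x \<in> carrier_vec N" for x
    using vec_norm2_skew_block_ge[of "T - D" M x 0 1] minus_carrier_mat[OF carrier(3)] sym' that
    by (simp add: R_block N_def)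
  have Z_le: "vec_norm2 (Z *\<^sub>v x) \<le> t * vec_norm2 x" if "x \<in> carrier_vec N" for x
    using vec_norm2_skew_block_le[OF carrier(3) sym(3) _ D_le, of x \<omega>] that
    by (simp add: Z_def N_def t_def)
  have KA_le: "vec_norm2 (KA *\<^sub>v x) \<le> \<beta>\<^sub>A * vec_norm2 x" if "x \<in> carrier_vec N" for x
    using vec_norm2_skew_block_le[OF carrier(4) sym(4) _ A_le, of x 0] that ab
    by (simp add: KA_def N_def)
  have KB_le: "vec_norm2 (KB *\<^sub>v x) \<le> \<beta>\<^sub>B * vec_norm2 x" if "x \<in> carrier_vec N" for x
    using vec_norm2_skew_block_le[OF carrier(5) sym(5) _ B_le, of x 0] that ab
    by (simp add: KB_def N_def)
  obtain X' where X': "X' \<in> carrier_mat N N" "X * X' = 1\<^sub>m N" "X' * X = 1\<^sub>m N"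
    "\<And>x. x \<in> carrier_vec N \<Longrightarrow> vec_norm2 (X' *\<^sub>v x) \<le> (1 / (\<omega> + 1)) * vec_norm2 x"
    using ex_inverse_mat[OF mats(1) \<omega>1 X_ge] by metis
  obtain Y' where Y': "Y' \<in> carrier_mat N N" "Y * Y' = 1\<^sub>m N" "Y' * Y = 1\<^sub>m N"
    "\<And>x. x \<in> carrier_vec N \<Longrightarrow> vec_norm2 (Y' *\<^sub>v x) \<le> (1 / s) * vec_norm2 x"
    using ex_inverse_mat[OF mats(2) s Y_ge] by metis
  obtain W' where W': "W' \<in> carrier_mat N N" "W * W' = 1\<^sub>m N" "W' * W = 1\<^sub>m N"
    "\<And>x. x \<in> carrier_vec N \<Longrightarrow> vec_norm2 (W' *\<^sub>v x) \<le> (1 / \<omega>) * vec_norm2 x"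
    using ex_inverse_mat[OF mats(3) \<omega> W_ge] by metis
  obtain R' where R': "R' \<in> carrier_mat N N" "R * R' = 1\<^sub>m N" "R' * R = 1\<^sub>m N"
    using ex_inverse_mat[OF R _ R_ge, simplified] by blast
  have inv_T: "mat_inv (precond N \<omega> (blk_IX M T) (blk_D M D)) = 2 * \<omega> \<cdot>\<^sub>m (W' * X')"
    unfolding precond_def blk_IX[OF carrier(1)] blk_D X_def[symmetric]
    using mats X' W' \<omega> by (intro mat_inv_precond) auto
  have inv_C: "mat_inv (precond N \<omega> (blk_IX M C) (blk_D M D)) = 2 * \<omega> \<cdot>\<^sub>m (W' * Y')"
    unfolding precond_def blk_IX[OF carrier(2)] blk_D Y_def[symmetric]
    using mats Y' W' \<omega> by (intro mat_inv_precond) auto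
  have pert: "Y' = X' + (Y' * KA * X' + Y' * KB * X')"
    using inverse_perturbation[OF mats(1,2,5,6) X'(1) Y'(1) X'(2) Y'(3) X_eq] .
  \<comment> \<open>Bracketed so that everything right of \<open>K\<close> is the invertible
    \<open>X' * R\<close>: this serves the rank count and keeps the product X' R together for the
    norm bound.\<close>
  define pt where "pt K = (2 * \<omega> \<cdot>\<^sub>m (W' * (Y' * K))) * (X' * R)" for K
  have pt: "pt K \<in> carrier_mat N N" if "K \<in> carrier_mat N N" for K
    using that X'(1) Y'(1) W'(1) R unfolding pt_def
    by (intro mult_carrier_mat[of _ N N _ N] smult_carrier_mat)
  have pt_alt: "(2 * \<omega> \<cdot>\<^sub>m (W' * (Y' * K * X'))) * R = pt K" if K: "K \<in> carrier_mat N N" for K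
    using K X'(1) Y'(1) W'(1) R
    by (simp add: pt_def mult_smult_assoc_mat[of _ N N _ N] assoc_mult_mat[of _ N N _ N _ N])
  have "(2 * \<omega> \<cdot>\<^sub>m (W' * Y')) * R
      = (2 * \<omega> \<cdot>\<^sub>m (W' * (X' + (Y' * KA * X' + Y' * KB * X')))) * R"
    by (rule arg_cong[OF pert, of "\<lambda>V. (2 * \<omega> \<cdot>\<^sub>m (W' * V)) * R"])
  also have "\<dots> = (2 * \<omega> \<cdot>\<^sub>m (W' * X')) * R + ((2 * \<omega> \<cdot>\<^sub>m (W' * (Y' * KA * X'))) * R
      + (2 * \<omega> \<cdot>\<^sub>m (W' * (Y' * KB * X'))) * R)"
    using mats(5,6) X'(1) Y'(1) W'(1) R
    by (simp add: mult_add_distrib_mat[of _ N N _ N] add_mult_distrib_mat[of _ N N _ _ N]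
        add_smult_distrib_left_mat[of _ N N])
  also have "\<dots> = (2 * \<omega> \<cdot>\<^sub>m (W' * X')) * R + pt KA + pt KB"
    unfolding pt_alt[OF mats(5)] pt_alt[OF mats(6)] using X'(1) W'(1) R
    by (intro assoc_add_mat[symmetric, of _ N N] pt mats mult_carrier_mat[of _ N N] smult_carrier_mat)
  finally have eq: "(2 * \<omega> \<cdot>\<^sub>m (W' * Y')) * R = (2 * \<omega> \<cdot>\<^sub>m (W' * X')) * R + pt KA + pt KB" .
  have XR_le: "vec_norm2 ((X' * R) *\<^sub>v x) \<le> (1 + t / (\<omega> + 1)) * vec_norm2 x" if x: "x \<in> carrier_vec N" for x
  proof -
    have Zx: "Z *\<^sub>v x \<in> carrier_vec N" "X' *\<^sub>v (Z *\<^sub>v x) \<in> carrier_vec N"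
      using mats X' x by auto
    \<comment> \<open>Substituting \<R> = X - Z cancels X, so that only Z, bounded through D, is
      left to estimate.\<close>
    have "X' * R = 1\<^sub>m N - X' * Z"
      unfolding R_eq using mats X' by (simp add: mult_minus_distrib_mat[of _ N N _ N])
    then have "(X' * R) *\<^sub>v x = x - X' *\<^sub>v (Z *\<^sub>v x)"
      using mats X' x by (simp add: minus_mult_distrib_mat_vec[of _ N N])
    then have "vec_norm2 ((X' * R) *\<^sub>v x) \<le> vec_norm2 x + vec_norm2 (X' *\<^sub>v (Z *\<^sub>v x))"
      using vec_norm2_triangle_minus[OF x Zx(2)] by simp
    also have "vec_norm2 (X' *\<^sub>v (Z *\<^sub>v x)) \<le> (1 / (\<omega> + 1)) * vec_norm2 (Z *\<^sub>v x)"
      using X'(4)[OF Zx(1)] .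
    also have "\<dots> \<le> (1 / (\<omega> + 1)) * (t * vec_norm2 x)"
      using Z_le[OF x] \<omega> by (intro mult_left_mono) auto
    finally show ?thesis
      by (simp add: algebra_simps)
  qed
  have pt_le: "mat_norm2 (pt K) \<le> \<kappa> * \<beta>" if K: "K \<in> carrier_mat N N" and \<beta>: "0 \<le> \<beta>"
    and K_le: "\<And>x. x \<in> carrier_vec N \<Longrightarrow> vec_norm2 (K *\<^sub>v x) \<le> \<beta> * vec_norm2 x" for K \<beta>
  proof (rule mat_norm2_le[OF pt[OF K] N(2)])
    fix x :: "real vec" assume x: "x \<in> carrier_vec N"
    define y where "y = (X' * R) *\<^sub>v x"
    have y: "y \<in> carrier_vec N" "K *\<^sub>v y \<in> carrier_vec N" "Y' *\<^sub>v (K *\<^sub>v y) \<in> carrier_vec N"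
      using X'(1) Y'(1) R K x by (auto simp: y_def)
    have "pt K *\<^sub>v x = (2 * \<omega> \<cdot>\<^sub>m (W' * (Y' * K))) *\<^sub>v y"
      unfolding pt_def y_def using X'(1) Y'(1) W'(1) R K x by (intro assoc_mult_mat_vec) auto
    also have "\<dots> = 2 * \<omega> \<cdot>\<^sub>v ((W' * (Y' * K)) *\<^sub>v y)"
      using W'(1) Y'(1) K y by (intro eq_vecI) auto
    also have "(W' * (Y' * K)) *\<^sub>v y = W' *\<^sub>v (Y' *\<^sub>v (K *\<^sub>v y))"
      using W'(1) Y'(1) K y by (simp add: assoc_mult_mat_vec[of _ N N _ N])
    finally have "vec_norm2 (pt K *\<^sub>v x) = 2 * \<omega> * vec_norm2 (W' *\<^sub>v (Y' *\<^sub>v (K *\<^sub>v y)))"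
      using \<omega> by (simp add: vec_norm2_smult)
    also have "\<dots> \<le> 2 * \<omega> * ((1 / \<omega>) * ((1 / s) * (\<beta> * ((1 + t / (\<omega> + 1)) * vec_norm2 x))))"
    proof (intro mult_left_mono)
      have "vec_norm2 (W' *\<^sub>v (Y' *\<^sub>v (K *\<^sub>v y))) \<le> (1 / \<omega>) * vec_norm2 (Y' *\<^sub>v (K *\<^sub>v y))"
        by (rule W'(4)[OF y(3)])
      also have "\<dots> \<le> (1 / \<omega>) * ((1 / s) * vec_norm2 (K *\<^sub>v y))"
        using Y'(4)[OF y(2)] \<omega> by (intro mult_left_mono) auto
      also have "\<dots> \<le> (1 / \<omega>) * ((1 / s) * (\<beta> * vec_norm2 y))"
        using K_le[OF y(1)] \<omega> s by (intro mult_left_mono) auto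
      also have "\<dots> \<le> (1 / \<omega>) * ((1 / s) * (\<beta> * ((1 + t / (\<omega> + 1)) * vec_norm2 x)))"
        using XR_le[OF x] \<omega> s \<beta> unfolding y_def by (intro mult_left_mono) auto
      finally show "vec_norm2 (W' *\<^sub>v (Y' *\<^sub>v (K *\<^sub>v y)))
        \<le> (1 / \<omega>) * ((1 / s) * (\<beta> * ((1 + t / (\<omega> + 1)) * vec_norm2 x)))" .
    qed (use \<omega> in auto)
    also have "\<dots> = \<kappa> * \<beta> * vec_norm2 x"
      using \<omega> by (simp add: \<kappa>_def s_def t_def)
    finally show "vec_norm2 (pt K *\<^sub>v x) \<le> \<kappa> * \<beta> * vec_norm2 x" .
  qed
  have rank: "mat_rank (pt KA) = card (J \<union> (+) M ` J)"
    unfolding pt_def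
  \<comment> \<open>\<open>R' * X\<close> is the inverse of \<open>X' * R\<close>; the factors left
    of \<open>KA\<close> are injective and are cancelled one by one below.\<close>
  proof (rule mat_rank_mult_invertible[where N' = "R' * X"])
    show "2 * \<omega> \<cdot>\<^sub>m (W' * (Y' * KA)) \<in> carrier_mat N N"
      "X' * R \<in> carrier_mat N N" "R' * X \<in> carrier_mat N N"
      using mats X'(1) Y'(1) W'(1) R R'(1) by auto
    have "(X' * R) * (R' * X) = X' * ((R * R') * X)"
      using mats X'(1) R R'(1) by (simp add: assoc_mult_mat[of _ N N _ N _ N])
    also have "\<dots> = 1\<^sub>m N"
      using mats(1) X'(3) R'(2) by simp
    finally show "(X' * R) * (R' * X) = 1\<^sub>m N" .
    show "J \<union> (+) M ` J \<subseteq> {..<N}"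
      using J by (auto simp: N_def)
    have mult: "(2 * \<omega> \<cdot>\<^sub>m (W' * (Y' * KA))) *\<^sub>v x = 2 * \<omega> \<cdot>\<^sub>v (W' *\<^sub>v (Y' *\<^sub>v (KA *\<^sub>v x)))"
      if x: "x \<in> carrier_vec N" for x
    proof -
      have "(2 * \<omega> \<cdot>\<^sub>m (W' * (Y' * KA))) *\<^sub>v x = 2 * \<omega> \<cdot>\<^sub>v ((W' * (Y' * KA)) *\<^sub>v x)"
        using W'(1) Y'(1) mats x by (intro eq_vecI) auto
      also have "(W' * (Y' * KA)) *\<^sub>v x = W' *\<^sub>v (Y' *\<^sub>v (KA *\<^sub>v x))"
        using W'(1) Y'(1) mats x by (simp add: assoc_mult_mat_vec[of _ N N _ N])
      finally show ?thesis .
    qed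
    show "(2 * \<omega> \<cdot>\<^sub>m (W' * (Y' * KA))) *\<^sub>v x = 0\<^sub>v N"
      if x: "x \<in> carrier_vec N" and supp: "\<And>j. j \<in> J \<union> (+) M ` J \<Longrightarrow> x $ j = 0" for x
    proof -
      have "KA *\<^sub>v x = 0\<^sub>v N"
        unfolding KA_def N_def
      proof (rule skew_block_mult_vec_eq_0[OF carrier(4) J])
        show "A *\<^sub>v p = 0\<^sub>v M" if "p \<in> carrier_vec M" "\<And>j. j \<in> J \<Longrightarrow> p $ j = 0" for p
          using that by (rule zero)
        show "x $ j = 0" if "j \<in> J \<union> (+) M ` J" for j
          using that by (rule supp)
      qed (use x in \<open>simp add: N_def\<close>)
      then show ?thesis
        unfolding mult[OF x] using W'(1) Y'(1) by (intro eq_vecI) (auto simp: scalar_prod_def)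
    qed
    show "x = 0\<^sub>v N"
      if x: "x \<in> carrier_vec N" and supp: "\<And>j. j < N \<Longrightarrow> j \<notin> J \<union> (+) M ` J \<Longrightarrow> x $ j = 0"
        and eq0: "(2 * \<omega> \<cdot>\<^sub>m (W' * (Y' * KA))) *\<^sub>v x = 0\<^sub>v N" for x
    proof -
      have KAx: "KA *\<^sub>v x \<in> carrier_vec N" "Y' *\<^sub>v (KA *\<^sub>v x) \<in> carrier_vec N"
        using mats Y'(1) x by auto
      have "W' *\<^sub>v (Y' *\<^sub>v (KA *\<^sub>v x)) = 0\<^sub>v N"
      proof (rule eq_vecI)
        fix i assume "i < dim_vec (0\<^sub>v N :: real vec)"
        then show "(W' *\<^sub>v (Y' *\<^sub>v (KA *\<^sub>v x))) $ i = 0\<^sub>v N $ i"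
          using arg_cong[OF eq0[unfolded mult[OF x]], of "\<lambda>v. vec_index v i"] W'(1) \<omega> by simp
      qed (use W'(1) in simp)
      then have "Y' *\<^sub>v (KA *\<^sub>v x) = 0\<^sub>v N"
        using mult_mat_vec_eq_0_cancel[OF W'(1) mats(3) W'(2) KAx(2)] by simp
      then have KA_0: "KA *\<^sub>v x = 0\<^sub>v N"
        using mult_mat_vec_eq_0_cancel[OF Y'(1) mats(2) Y'(2) KAx(1)] by simp
      show ?thesis
        unfolding N_def
      proof (rule skew_block_inj_on_support[OF carrier(4) _ _ _ J])
        show "p = 0\<^sub>v M" if "p \<in> carrier_vec M" "\<And>j. j < M \<Longrightarrow> j \<notin> J \<Longrightarrow> p $ j = 0"
          "A *\<^sub>v p = 0\<^sub>v M" for p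
          using that by (rule inj)
        show "x $ j = 0" if "j < M + M" "j \<notin> J \<union> (+) M ` J" for j
          using that unfolding N_def[symmetric] by (rule supp)
      qed (use x KA_0 in \<open>simp_all add: N_def KA_def\<close>)
    qed
  qed
  have "card (J \<union> (+) M ` J) = 2 * card J"
    using J by (subst card_Un_disjoint) (auto simp: card_image finite_subset)
  then show ?thesis
    unfolding N(1) inv_T inv_C using rank eq pt[OF mats(5)] pt[OF mats(6)]
      pt_le[OF mats(5) ab(1) KA_le] pt_le[OF mats(6) ab(2) KB_le] by auto
qed

section \<open>The Strang approximation\<close>

lemma strang_coef_reflect:
  assumes "0 < k" "k < M"
  shows "strang_coef \<alpha> M (M - k) = strang_coef \<alpha> M k"
  using assms by (auto simp: strang_coef_def of_nat_diff)

lemma toeplitz_T_eq: "toeplitz_T \<alpha> \<mu> M = sym_toeplitz M (\<lambda>m. \<mu> * frac_coef \<alpha> (int m))"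
  unfolding toeplitz_T_def sym_toeplitz_def by (simp add: frac_coef_abs)

text \<open>For j > i the residue of i - j is M - (j - i), and the reflection symmetry of the
  coefficients turns it into the distance.\<close>

lemma strang_C_eq: "strang_C \<alpha> \<mu> M = sym_toeplitz M (\<lambda>m. \<mu> * strang_coef \<alpha> M m)"
proof -
  have "strang_coef \<alpha> M (nat ((int i - int j) mod int M)) = strang_coef \<alpha> M (nat \<bar>int i - int j\<bar>)"
    if ij: "i < M" "j < M" for i j
  proof (cases "j \<le> i")
    case True
    then show ?thesis
      using ij by simp
  next
    case False
    then have "(int i - int j) mod int M = int (M - (j - i))"
      using ij by (intro int_mod_pos_eq[where q = "-1"] mod_pos_geq) auto
    then have "nat ((int i - int j) mod int M) = M - (j - i)"
      by (simp only: nat_int)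
    moreover have "nat \<bar>int i - int j\<bar> = j - i"
      using False by simp
    ultimately show ?thesis
      using False ij strang_coef_reflect[of "j - i" M \<alpha>] by simp
  qed
  then show ?thesis
    unfolding strang_C_def sym_toeplitz_def by (intro eq_matI) auto
qed

definition strang_gap :: "real \<Rightarrow> nat \<Rightarrow> nat \<Rightarrow> real" where
  "strang_gap \<alpha> M m = frac_coef \<alpha> (int m) - strang_coef \<alpha> M m"

lemma strang_gap_near: "2 * m < M \<Longrightarrow> strang_gap \<alpha> M m = 0"
  by (simp add: strang_gap_def strang_coef_def)

text \<open>For m < M/2 the gap is the difference of c at M - m and at m, with c_m < c_(M-m) < 0; at
  m = M/2 the Strang coefficient is 0 and the gap is c_m itself. Nonvanishing makes the rank
  exact.\<close>

lemma strang_gap_far: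
  assumes "0 < \<alpha>" "\<alpha> < 2" "1 \<le> m" "2 * m \<le> M"
  shows "strang_gap \<alpha> M (M - m) \<noteq> 0" "\<bar>strang_gap \<alpha> M (M - m)\<bar> \<le> - frac_coef \<alpha> (int m)"
proof -
  have neg: "frac_coef \<alpha> (int m) < 0" "frac_coef \<alpha> (int (M - m)) < 0"
    using assms by (intro frac_coef_neg; simp)+
  have "strang_gap \<alpha> M (M - m) \<noteq> 0 \<and> \<bar>strang_gap \<alpha> M (M - m)\<bar> \<le> - frac_coef \<alpha> (int m)"
  proof (cases "2 * m = M")
    case True
    then have "strang_gap \<alpha> M (M - m) = frac_coef \<alpha> (int m)"
      by (auto simp: strang_gap_def strang_coef_def)
    then show ?thesis
      using neg by simp
  next
    case False
    then have "\<not> 2 * (M - m) < M" "2 * (M - m) \<noteq> M" "int M - int (M - m) = int m"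
      using assms by auto
    then have "strang_gap \<alpha> M (M - m) = frac_coef \<alpha> (int (M - m)) - frac_coef \<alpha> (int m)"
      unfolding strang_gap_def strang_coef_def by simp
    moreover have "frac_coef \<alpha> (int m) < frac_coef \<alpha> (int (M - m))"
      using assms False by (intro frac_coef_strict_mono) auto
    ultimately show ?thesis
      using neg by simp
  qed
  then show "strang_gap \<alpha> M (M - m) \<noteq> 0" "\<bar>strang_gap \<alpha> M (M - m)\<bar> \<le> - frac_coef \<alpha> (int m)"
    by auto
qed

text \<open>Reflection makes the two halves equal and the middle term is 0. The deficit against the
  diagonal coefficient, twice a tail, is the diagonal-dominance surplus of C.\<close>

lemma sum_abs_strang_coef:
  assumes \<alpha>: "0 < \<alpha>" "\<alpha> < 2" and M: "M = 2 * K" "1 \<le> K"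
  shows "(\<Sum>m = 1..<M. \<bar>strang_coef \<alpha> M m\<bar>) = frac_coef \<alpha> 0 - 2 * coef_tail \<alpha> K"
proof -
  have "{1..<M} = {1..<K} \<union> ({K} \<union> {Suc K..<M})"
    using M by auto
  then have "(\<Sum>m = 1..<M. \<bar>strang_coef \<alpha> M m\<bar>) = (\<Sum>m = 1..<K. \<bar>strang_coef \<alpha> M m\<bar>)
      + (\<Sum>m \<in> {K} \<union> {Suc K..<M}. \<bar>strang_coef \<alpha> M m\<bar>)"
    by (simp only:) (subst sum.union_disjoint, auto)
  also have "(\<Sum>m \<in> {K} \<union> {Suc K..<M}. \<bar>strang_coef \<alpha> M m\<bar>)
      = (\<Sum>m = Suc K..<M. \<bar>strang_coef \<alpha> M m\<bar>)"
    using M by (simp add: strang_coef_def)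
  also have "\<dots> = (\<Sum>m = 1..<K. \<bar>strang_coef \<alpha> M m\<bar>)"
    using M by (intro sum.reindex_bij_witness[of _ "\<lambda>m. M - m" "\<lambda>m. M - m"])
      (auto simp: strang_coef_reflect)
  also have "(\<Sum>m = 1..<K. \<bar>strang_coef \<alpha> M m\<bar>) = (\<Sum>m = 1..<K. - frac_coef \<alpha> (int m))"
    using M frac_coef_neg[OF \<alpha>] by (intro sum.cong) (auto simp: strang_coef_def abs_of_neg)
  also have "\<dots> = frac_coef \<alpha> 0 / 2 - coef_tail \<alpha> K"
    using sum_frac_coef[OF \<alpha> _ M(2)] coef_tail_1[OF \<alpha>] by simp
  finally show ?thesis
    by simp
qed

lemma diag_D_norm_le:
  assumes "\<And>j. j < M \<Longrightarrow> 0 \<le> d j" "\<And>j. j < M \<Longrightarrow> d j \<le> \<nu>" "0 \<le> \<nu>" "u \<in> carrier_vec M"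
  shows "vec_norm2 (diag_D M d *\<^sub>v u) \<le> \<nu> * vec_norm2 u"
proof (rule vec_norm2_mult_le_row_sum)
  show "diag_D M d \<in> carrier_mat M M"
    by (simp add: diag_D_def)
  show "(diag_D M d)\<^sup>T = diag_D M d"
    by (intro eq_matI) (auto simp: diag_D_def)
  show "(\<Sum>j = 0..<M. \<bar>diag_D M d $$ (i, j)\<bar>) \<le> \<nu>" if "i < M" for i
  proof -
    have "(\<Sum>j = 0..<M. \<bar>diag_D M d $$ (i, j)\<bar>) = (\<Sum>j = 0..<M. if j = i then d i else 0)"
      using that assms(1) by (intro sum.cong) (auto simp: diag_D_def)
    then show ?thesis
      using that assms(2) by simp
  qed
qed (use assms in auto)

text \<open>With q = sqrt (\<omega>^2 + \<nu>^2) / \<omega> \<ge> 1 both summands are at most q^2,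
  and 2 < sqrt 8. This is the source of strictness in both norm bounds.\<close>

lemma amplification_less:
  fixes \<omega> \<nu> m :: real
  assumes "0 < \<omega>" "8 \<le> m"
  shows "1 + sqrt (\<omega>\<^sup>2 + \<nu>\<^sup>2) / (\<omega> + 1) < (\<omega>\<^sup>2 + \<nu>\<^sup>2) * sqrt m / \<omega>\<^sup>2"
proof -
  define t where "t = sqrt (\<omega>\<^sup>2 + \<nu>\<^sup>2)"
  have t: "t\<^sup>2 = \<omega>\<^sup>2 + \<nu>\<^sup>2"
    by (simp add: t_def)
  have "\<omega> \<le> t"
    using real_sqrt_ge_abs1[of \<omega> \<nu>] assms by (simp add: t_def)
  then have q: "1 \<le> t / \<omega>"
    using assms by (simp add: field_simps)
  have "t / (\<omega> + 1) \<le> t / \<omega>"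
    using assms \<open>\<omega> \<le> t\<close> by (intro divide_left_mono) auto
  also have "\<dots> \<le> (t / \<omega>)\<^sup>2"
    using mult_right_mono[OF q, of "t / \<omega>"] q by (simp add: power2_eq_square)
  finally have "1 + t / (\<omega> + 1) \<le> 2 * (t / \<omega>)\<^sup>2"
    using power_mono[OF q, of 2] by simp
  also have "2 < sqrt m"
    using assms by (intro real_less_rsqrt) auto
  then have "2 * (t / \<omega>)\<^sup>2 < sqrt m * (t / \<omega>)\<^sup>2"
    using q by (intro mult_strict_right_mono zero_less_power) auto
  also have "\<dots> = (\<omega>\<^sup>2 + \<nu>\<^sup>2) * sqrt m / \<omega>\<^sup>2"
    by (simp add: power_divide t)
  finally show ?thesis
    unfolding t_def .
qed

text \<open>Put z = (c/\<epsilon>)^(1/\<alpha>). The upper bound on \<epsilon> gives z \<ge> 1, the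
  lower bound gives z < M/2 - 1, and k - 1 is the ceiling of z. As M/2 - 1 is an integer, rounding
  up does not exceed it, so the corners fit.\<close>

lemma corner_size:
  fixes M :: nat
  assumes \<alpha>: "1 < \<alpha>" and c: "0 < c" and \<epsilon>: "2 powr \<alpha> * c / (real M - 2) powr \<alpha> < \<epsilon>" "\<epsilon> \<le> c"
    and M: "8 \<le> M" "even M"
  defines "k \<equiv> nat (\<lceil>(c / \<epsilon>) powr (1 / \<alpha>)\<rceil> + 1)"
  shows "int k = \<lceil>(c / \<epsilon>) powr (1 / \<alpha>)\<rceil> + 1" "2 \<le> k" "2 * k \<le> M"
    "c / (real k - 1) powr \<alpha> \<le> \<epsilon>"
proof -
  define z where "z = (c / \<epsilon>) powr (1 / \<alpha>)"
  have "0 < 2 powr \<alpha> * c / (real M - 2) powr \<alpha>"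
    using c M by simp
  then have "0 < \<epsilon>"
    using \<epsilon>(1) by linarith
  then have "1 \<le> z"
    unfolding z_def using \<epsilon>(2) \<alpha> by (intro ge_one_powr_ge_zero) auto
  then show k: "int k = \<lceil>(c / \<epsilon>) powr (1 / \<alpha>)\<rceil> + 1"
    unfolding k_def z_def[symmetric] by simp
  then have k': "int k = \<lceil>z\<rceil> + 1"
    by (simp add: z_def)
  have "1 \<le> \<lceil>z\<rceil>"
    using \<open>1 \<le> z\<close> by linarith
  then show "2 \<le> k"
    using k' by linarith
  have z_powr: "z powr \<alpha> = c / \<epsilon>"
    using \<alpha> c \<open>0 < \<epsilon>\<close> by (simp add: z_def powr_powr)
  have "c / \<epsilon> < ((real M - 2) / 2) powr \<alpha>"
  proof -
    define p q where "p = (real M - 2) powr \<alpha>" and "q = 2 powr \<alpha>"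
    have pq: "0 < p" "0 < q"
      using M by (auto simp: p_def q_def)
    have "q * c < \<epsilon> * p"
      using \<epsilon>(1) pq by (simp add: pos_divide_less_eq flip: p_def q_def)
    then have "c / \<epsilon> < p / q"
      using pq \<open>0 < \<epsilon>\<close> by (simp add: pos_divide_less_eq pos_less_divide_eq mult_ac)
    then show ?thesis
      using M by (simp add: powr_divide p_def q_def)
  qed
  then have "z powr \<alpha> < ((real M - 2) / 2) powr \<alpha>"
    by (simp only: z_powr)
  then have "z < (real M - 2) / 2"
    by (rule powr_less_cancel2[rotated 3]) (use \<alpha> M \<open>1 \<le> z\<close> in auto)
  moreover obtain K where "M = 2 * K"
    using M by (auto elim: evenE)
  ultimately have "z \<le> of_int (int K - 1)"
    by simp
  then have "\<lceil>z\<rceil> \<le> int K - 1"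
    by (rule ceiling_le)
  then show "2 * k \<le> M"
    using k' \<open>M = 2 * K\<close> by linarith
  have "z \<le> real k - 1"
    using k' le_of_int_ceiling[of z] by linarith
  then have "c / \<epsilon> \<le> (real k - 1) powr \<alpha>"
    using \<open>1 \<le> z\<close> \<alpha> unfolding z_powr[symmetric] by (intro powr_mono2) auto
  then show "c / (real k - 1) powr \<alpha> \<le> \<epsilon>"
    using \<open>0 < \<epsilon>\<close> \<open>2 \<le> k\<close> by (simp add: field_simps)
qed

theorem theorem4p4:
  fixes \<alpha> \<gamma> \<tau> a b \<omega> \<epsilon> :: real and M :: nat and d :: "nat \<Rightarrow> real"
  assumes "1 < \<alpha>" "\<alpha> < 2" "0 < \<gamma>" "0 < \<tau>" "a < b"
    and "8 \<le> M" "even M" "0 < \<omega>"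
    and "\<And>j. j < M \<Longrightarrow> 0 \<le> d j"
  defines "h \<equiv> (b - a) / (real M + 1)"
  defines "\<mu> \<equiv> \<gamma> * \<tau> / h powr \<alpha>"
  defines "\<theta> \<equiv> theta_const \<alpha>" and "\<theta>\<^sub>0 \<equiv> theta0_const \<alpha>"
  assumes "2 powr \<alpha> * \<mu> * \<theta>\<^sub>0 / (real M - 2) powr \<alpha> < \<epsilon>" and "\<epsilon> \<le> \<mu> * \<theta>\<^sub>0"
  defines "k\<^sub>0 \<equiv> \<lceil>(\<mu> * \<theta>\<^sub>0 / \<epsilon>) powr (1 / \<alpha>)\<rceil> + 1"
  defines "\<nu> \<equiv> Max (d ` {..<M})"
  defines "T \<equiv> toeplitz_T \<alpha> \<mu> M" and "C \<equiv> strang_C \<alpha> \<mu> M" and "D \<equiv> diag_D M d"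
  defines "\<R> \<equiv> four_block_mat (1\<^sub>m M) (T - D) (D - T) (1\<^sub>m M)"
  defines "F \<equiv> precond (2 * M) \<omega> (blk_IX M T) (blk_D M D)"
  defines "Ft \<equiv> precond (2 * M) \<omega> (blk_IX M C) (blk_D M D)"
  defines "den \<equiv> \<omega>\<^sup>2 * sqrt ((\<omega> + 1)\<^sup>2 + (2 powr (\<alpha> + 1) * \<gamma> * \<tau> * \<theta> / (b - a) powr \<alpha>)\<^sup>2)"
  shows "\<exists>P Q. P \<in> carrier_mat (2 * M) (2 * M) \<and> Q \<in> carrier_mat (2 * M) (2 * M)
           \<and> mat_inv Ft * \<R> = mat_inv F * \<R> + P + Q
           \<and> int (mat_rank P) = 4 * k\<^sub>0
           \<and> mat_norm2 P < 2 * (\<omega>\<^sup>2 + \<nu>\<^sup>2) * sqrt (real M) * \<mu> / den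
                 * (frac_coef \<alpha> 0 / 2 - \<theta> / (real M - 1/2) powr \<alpha>)
           \<and> mat_norm2 Q < 2 * (\<omega>\<^sup>2 + \<nu>\<^sup>2) * sqrt (real M) * \<epsilon> / den"
proof -
  have \<alpha>: "0 < \<alpha>" "\<alpha> < 2" "1 < \<alpha>"
    using assms(1,2) by auto
  obtain K where K: "M = 2 * K" "4 \<le> K"
    using assms(6,7) by (auto elim!: evenE)
  have \<mu>: "0 < \<mu>"
    using assms(3-6) by (simp add: \<mu>_def h_def)
  define G where "G = asymp_const \<alpha>"
  have G: "0 < G" "\<theta> \<le> G" "G \<le> \<theta>\<^sub>0" "0 < \<theta>"
    using asymp_const_pos theta_const_le asymp_const_le_theta0 theta_const_pos \<alpha>
    by (auto simp: G_def \<theta>_def \<theta>\<^sub>0_def)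
  define k where "k = nat k\<^sub>0"
  have k: "int k = k\<^sub>0" "2 \<le> k" "2 * k \<le> M" "\<mu> * \<theta>\<^sub>0 / (real k - 1) powr \<alpha> \<le> \<epsilon>"
    using corner_size[of \<alpha> "\<mu> * \<theta>\<^sub>0" M \<epsilon>] assms(1,6,7,14,15) \<mu> G
    by (auto simp: k_def k\<^sub>0_def mult.assoc)
  define l where "l = 2 powr (\<alpha> + 1) * \<gamma> * \<tau> * \<theta> / (b - a) powr \<alpha>"
  define \<beta> where "\<beta> = \<mu> * (frac_coef \<alpha> 0 / 2 - \<theta> / (real M - 1/2) powr \<alpha>)"
  define S where "S = sqrt ((\<omega> + 1)\<^sup>2 + l\<^sup>2)"
  have S: "0 < S"
    using assms(8) by (auto simp: S_def intro!: add_pos_nonneg)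
  have l0: "0 \<le> l"
    using assms(3-5) G by (simp add: l_def)
  \<comment> \<open>Inserting h into \<mu> cancels the power of M + 1. The rest of the chain uses (M
    + 1)/2 \<ge> K and the sharp constant.\<close>
  have "l = 2 * (\<mu> * (\<theta> / ((real M + 1) / 2) powr \<alpha>))"
    using assms(5) by (simp add: l_def \<mu>_def h_def powr_divide powr_add)
  also have "\<theta> / ((real M + 1) / 2) powr \<alpha> \<le> G / real K powr \<alpha>"
    using K \<alpha> G by (intro frac_le powr_mono2) auto
  also have "\<dots> \<le> coef_tail \<alpha> K"
    using coef_tail_ge[of \<alpha> K] \<alpha> K by (simp add: G_def)
  finally have l_le: "l \<le> 2 * (\<mu> * coef_tail \<alpha> K)"
    using \<mu> by simp
  have "\<theta> / (real M - 1/2) powr \<alpha> \<le> G / real (Suc K) powr \<alpha>"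
    using K \<alpha> G by (intro frac_le powr_mono2) auto
  also have "\<dots> \<le> coef_tail \<alpha> (Suc K)"
    using coef_tail_ge[of \<alpha> "Suc K"] \<alpha> K by (simp add: G_def)
  finally have tail_K: "\<theta> / (real M - 1/2) powr \<alpha> \<le> coef_tail \<alpha> (Suc K)" .
  \<comment> \<open>All distances from M/2 on are summed, not just those in the corners, so
    \<open>\<beta>\<close> does not depend on \<open>k\<close>.\<close>
  have sum_le: "(\<Sum>m = 1..K. \<mu> * - frac_coef \<alpha> (int m)) \<le> \<beta>"
  proof -
    have "(\<Sum>m = 1..<Suc K. - frac_coef \<alpha> (int m)) = frac_coef \<alpha> 0 / 2 - coef_tail \<alpha> (Suc K)"
      using sum_frac_coef[OF \<alpha>(1,2), of 1 "Suc K"] coef_tail_1[OF \<alpha>(1,2)] by simp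
    also have "\<dots> \<le> frac_coef \<alpha> 0 / 2 - \<theta> / (real M - 1/2) powr \<alpha>"
      using tail_K by simp
    finally show ?thesis
      using \<mu> unfolding \<beta>_def sum_distrib_left[symmetric] atLeastLessThanSuc_atLeastAtMost by simp
  qed
  have "0 < (\<Sum>m = 1..K. \<mu> * - frac_coef \<alpha> (int m))"
    using K \<mu> frac_coef_neg[OF \<alpha>(1,2)] by (intro sum_pos) (auto simp: mult_pos_neg)
  then have \<beta>: "0 < \<beta>"
    using sum_le by linarith
  \<comment> \<open>The corners take m \<le> k, so the remainder starts at k + 1; its tail is
    controlled by (k - 1)^(-\<alpha>), which explains the extra 1 in
    \<open>k\<^sub>0\<close>.\<close>
  have sum_le': "(\<Sum>m = Suc k..K. \<mu> * - frac_coef \<alpha> (int m)) \<le> \<epsilon>"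
  proof -
    have "(\<Sum>m = Suc k..<Suc K. - frac_coef \<alpha> (int m)) = coef_tail \<alpha> (Suc k) - coef_tail \<alpha> (Suc K)"
      using k K by (intro sum_frac_coef \<alpha>) auto
    also have "\<dots> \<le> coef_tail \<alpha> (Suc k)"
      using coef_tail_pos[of \<alpha> "Suc K"] \<alpha> by simp
    also have "\<dots> \<le> G / (real k - 1) powr \<alpha>"
      unfolding G_def using \<alpha> k by (intro coef_tail_Suc_le) auto
    also have "\<dots> \<le> \<theta>\<^sub>0 / (real k - 1) powr \<alpha>"
      using G k by (intro divide_right_mono) auto
    finally have "\<mu> * (\<Sum>m = Suc k..<Suc K. - frac_coef \<alpha> (int m)) \<le> \<mu> * (\<theta>\<^sub>0 / (real k - 1) powr \<alpha>)"
      using \<mu> by (intro mult_left_mono) auto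
    then show ?thesis
      using k(4) unfolding sum_distrib_left[symmetric] atLeastLessThanSuc_atLeastAtMost by simp
  qed
  have "0 < 2 powr \<alpha> * \<mu> * \<theta>\<^sub>0 / (real M - 2) powr \<alpha>"
    using \<mu> G assms(6) by simp
  then have \<epsilon>: "0 < \<epsilon>"
    using assms(14) by linarith
  have \<nu>: "d j \<le> \<nu>" if "j < M" for j
    using that by (simp add: \<nu>_def)
  then have "0 \<le> \<nu>"
    using assms(6) assms(9)[of 0] by (metis less_le_trans order_trans zero_less_numeral)
  \<comment> \<open>\<open>f\<close> is the part of T - C at distance at least M - k, the corners;
    \<open>g\<close> is the part at distance from M/2 up to M - k - 1.\<close>
  define f where "f m = (if M - k \<le> m then \<mu> * strang_gap \<alpha> M m else 0)" for m
  define g where "g m = (if M - k \<le> m then 0 else \<mu> * strang_gap \<alpha> M m)" for m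
  have near: "f m = 0" "g m = 0" if "2 * m < M" for m
    using that by (auto simp: f_def g_def strang_gap_near)
  have far: "\<bar>f (M - m)\<bar> \<le> \<mu> * - frac_coef \<alpha> (int m)"
    "\<bar>g (M - m)\<bar> \<le> (if m \<le> k then 0 else \<mu> * - frac_coef \<alpha> (int m))"
    if m: "1 \<le> m" "m \<le> K" for m
  proof -
    have "\<mu> * \<bar>strang_gap \<alpha> M (M - m)\<bar> \<le> \<mu> * - frac_coef \<alpha> (int m)"
      using strang_gap_far(2)[OF \<alpha>(1,2) m(1), of M] m K \<mu> by (intro mult_left_mono) auto
    moreover have "0 \<le> \<mu> * - frac_coef \<alpha> (int m)"
      using frac_coef_neg[OF \<alpha>(1,2) m(1)] \<mu> by (intro mult_nonneg_nonneg) auto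
    ultimately show "\<bar>f (M - m)\<bar> \<le> \<mu> * - frac_coef \<alpha> (int m)"
      "\<bar>g (M - m)\<bar> \<le> (if m \<le> k then 0 else \<mu> * - frac_coef \<alpha> (int m))"
      using \<mu> m K k(3) by (auto simp: f_def g_def abs_mult)
  qed
  have f_row: "(\<Sum>j = 0..<M. \<bar>sym_toeplitz M f $$ (i, j)\<bar>) \<le> \<beta>" if "i < M" for i
  proof -
    have "(\<Sum>j = 0..<M. \<bar>sym_toeplitz M f $$ (i, j)\<bar>) \<le> (\<Sum>m = 1..K. \<bar>f (M - m)\<bar>)"
      using sym_toeplitz_far_row_sum[of M f i] near that K by simp
    also have "\<dots> \<le> (\<Sum>m = 1..K. \<mu> * - frac_coef \<alpha> (int m))"
      using far by (intro sum_mono) auto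
    finally show ?thesis
      using sum_le by linarith
  qed
  have g_row: "(\<Sum>j = 0..<M. \<bar>sym_toeplitz M g $$ (i, j)\<bar>) \<le> \<epsilon>" if "i < M" for i
  proof -
    have "(\<Sum>j = 0..<M. \<bar>sym_toeplitz M g $$ (i, j)\<bar>) \<le> (\<Sum>m = 1..K. \<bar>g (M - m)\<bar>)"
      using sym_toeplitz_far_row_sum[of M g i] near that K by simp
    also have "\<dots> \<le> (\<Sum>m = 1..K. if m \<le> k then 0 else \<mu> * - frac_coef \<alpha> (int m))"
      using far by (intro sum_mono) auto
    also have "\<dots> = (\<Sum>m = Suc k..K. \<mu> * - frac_coef \<alpha> (int m))"
      by (intro sum.mono_neutral_cong_right) auto
    finally show ?thesis
      using sum_le' by linarith
  qed
  \<comment> \<open>The diagonal exceeds the off-diagonal row sum by 2 \<mu>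
    \<open>coef_tail \<alpha> K\<close>, which is at least \<open>l\<close>.\<close>
  have C_dom: "l + (\<Sum>j \<in> {0..<M} - {i}. \<bar>C $$ (i, j)\<bar>) \<le> C $$ (i, i)" if i: "i < M" for i
  proof -
    have "(\<Sum>j \<in> {0..<M} - {i}. \<bar>C $$ (i, j)\<bar>) = (\<Sum>m = 1..<M. \<bar>\<mu> * strang_coef \<alpha> M m\<bar>)"
      unfolding C_def strang_C_eq using i
      by (intro sym_toeplitz_circulant_row_sum) (auto simp: strang_coef_reflect)
    also have "\<dots> = \<mu> * (frac_coef \<alpha> 0 - 2 * coef_tail \<alpha> K)"
      using \<mu> sum_abs_strang_coef[OF \<alpha>(1,2) K(1)] K
      by (simp add: abs_mult flip: sum_distrib_left)
    also have "C $$ (i, i) = \<mu> * frac_coef \<alpha> 0"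
      using i unfolding C_def strang_C_eq by (simp add: sym_toeplitz_index strang_coef_def)
    ultimately show ?thesis
      using l_le by (simp add: algebra_simps)
  qed
  have C_ge: "l * vec_norm2 u \<le> vec_norm2 (C *\<^sub>v u)" if "u \<in> carrier_vec M" for u
    using that C_dom by (intro diag_dominant_norm_ge[of _ M]) (auto simp: C_def strang_C_eq transpose_sym_toeplitz)
  have T_eq: "T = C + (sym_toeplitz M f + sym_toeplitz M g)"
    unfolding T_def C_def toeplitz_T_eq strang_C_eq sym_toeplitz_add
    by (intro sym_toeplitz_cong) (auto simp: f_def g_def strang_gap_def algebra_simps)
  have f_corner: "f m = 0" if "m < M - k" for m
    using that by (simp add: f_def)
  \<comment> \<open>Distance M - k is the diagonal of the triangular corners; 2k = M is allowed,
    where the gap is c_k.\<close>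
  have f_diag: "f (M - k) \<noteq> 0"
    using strang_gap_far(1)[OF \<alpha>(1,2), of k M] k \<mu> by (simp add: f_def)
  define \<kappa> where "\<kappa> = 2 * (1 + sqrt (\<omega>\<^sup>2 + \<nu>\<^sup>2) / (\<omega> + 1)) / S"
  have "\<exists>P Q. P \<in> carrier_mat (2 * M) (2 * M) \<and> Q \<in> carrier_mat (2 * M) (2 * M)
    \<and> mat_inv Ft * \<R> = mat_inv F * \<R> + P + Q
    \<and> mat_rank P = 2 * card (outer_indices M k)
    \<and> mat_norm2 P \<le> \<kappa> * \<beta> \<and> mat_norm2 Q \<le> \<kappa> * \<epsilon>"
    unfolding \<kappa>_def S_def F_def Ft_def \<R>_def
  proof (rule preconditioner_perturbation[where A = "sym_toeplitz M f" and B = "sym_toeplitz M g"])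
    show "T = C + (sym_toeplitz M f + sym_toeplitz M g)"
      by (rule T_eq)
    show "T\<^sup>T = T"
      by (simp add: T_def toeplitz_T_eq transpose_sym_toeplitz)
    show "l * vec_norm2 u \<le> vec_norm2 (C *\<^sub>v u)" if "u \<in> carrier_vec M" for u
      using that by (rule C_ge)
    show "D\<^sup>T = D"
      by (intro eq_matI) (auto simp: D_def diag_D_def)
    show "vec_norm2 (D *\<^sub>v u) \<le> \<nu> * vec_norm2 u" if "u \<in> carrier_vec M" for u
      unfolding D_def using assms(9) \<nu> \<open>0 \<le> \<nu>\<close> that by (rule diag_D_norm_le)
    show "vec_norm2 (sym_toeplitz M f *\<^sub>v u) \<le> \<beta> * vec_norm2 u" if "u \<in> carrier_vec M" for u
      using that f_row \<beta> by (intro vec_norm2_mult_le_row_sum[of _ M]) (auto simp: transpose_sym_toeplitz)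
    show "vec_norm2 (sym_toeplitz M g *\<^sub>v u) \<le> \<epsilon> * vec_norm2 u" if "u \<in> carrier_vec M" for u
      using that g_row \<epsilon> by (intro vec_norm2_mult_le_row_sum[of _ M]) (auto simp: transpose_sym_toeplitz)
    show "outer_indices M k \<subseteq> {..<M}"
      using k by (auto simp: outer_indices_def)
    show "sym_toeplitz M f *\<^sub>v u = 0\<^sub>v M"
      if "u \<in> carrier_vec M" "\<And>j. j \<in> outer_indices M k \<Longrightarrow> u $ j = 0" for u
      using f_corner that by (rule corner_mult_vec_eq_0)
    show "u = 0\<^sub>v M"
      if "u \<in> carrier_vec M" "\<And>j. j < M \<Longrightarrow> j \<notin> outer_indices M k \<Longrightarrow> u $ j = 0"
        "sym_toeplitz M f *\<^sub>v u = 0\<^sub>v M" for u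
      using f_corner f_diag k(3) that by (rule corner_mult_vec_inj)
  qed (use assms(6,8) \<open>0 \<le> \<nu>\<close> l0 \<beta> \<epsilon> in
      \<open>auto simp: T_def C_def D_def diag_D_def toeplitz_T_eq strang_C_eq transpose_sym_toeplitz\<close>)
  then obtain P Q where PQ: "P \<in> carrier_mat (2 * M) (2 * M)" "Q \<in> carrier_mat (2 * M) (2 * M)"
    "mat_inv Ft * \<R> = mat_inv F * \<R> + P + Q" "mat_rank P = 2 * card (outer_indices M k)"
    "mat_norm2 P \<le> \<kappa> * \<beta>" "mat_norm2 Q \<le> \<kappa> * \<epsilon>"
    by blast
  have \<kappa>_less: "\<kappa> * x < 2 * (\<omega>\<^sup>2 + \<nu>\<^sup>2) * sqrt (real M) / den * x" if "0 < x" for x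
  proof -
    have "1 + sqrt (\<omega>\<^sup>2 + \<nu>\<^sup>2) / (\<omega> + 1) < (\<omega>\<^sup>2 + \<nu>\<^sup>2) * sqrt (real M) / \<omega>\<^sup>2"
      using amplification_less[OF assms(8), of "real M" \<nu>] assms(6) by simp
    then have "\<kappa> < 2 * ((\<omega>\<^sup>2 + \<nu>\<^sup>2) * sqrt (real M) / \<omega>\<^sup>2) / S"
      unfolding \<kappa>_def using S by (intro divide_strict_right_mono) auto
    also have "\<dots> = 2 * (\<omega>\<^sup>2 + \<nu>\<^sup>2) * sqrt (real M) / den"
      by (simp add: den_def S_def l_def)
    finally show ?thesis
      using that by (rule mult_strict_right_mono)
  qed
  from \<kappa>_less[OF \<beta>] \<kappa>_less[OF \<epsilon>]
  have "\<kappa> * \<beta> < 2 * (\<omega>\<^sup>2 + \<nu>\<^sup>2) * sqrt (real M) * \<mu> / den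
      * (frac_coef \<alpha> 0 / 2 - \<theta> / (real M - 1/2) powr \<alpha>)"
    "\<kappa> * \<epsilon> < 2 * (\<omega>\<^sup>2 + \<nu>\<^sup>2) * sqrt (real M) * \<epsilon> / den"
    by (simp_all add: \<beta>_def)
  then have "mat_norm2 P < 2 * (\<omega>\<^sup>2 + \<nu>\<^sup>2) * sqrt (real M) * \<mu> / den
      * (frac_coef \<alpha> 0 / 2 - \<theta> / (real M - 1/2) powr \<alpha>)"
    "mat_norm2 Q < 2 * (\<omega>\<^sup>2 + \<nu>\<^sup>2) * sqrt (real M) * \<epsilon> / den"
    using PQ(5,6) by linarith+
  moreover have "int (mat_rank P) = 4 * k\<^sub>0"
    using PQ(4) card_outer_indices[OF k(3)] k(1) by simp
  ultimately show ?thesis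
    using PQ(1-3) by blast
qed

end
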